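(* Let $S=\langle g_1,\dots,g_N\rangle$ be a finitely generated rational semigroup with generating set $\mathscr{G}=\{g_1,\dots,g_N\}$, and assume that $\deg(g_j)\geq 2$ for at least one $j\in\{1,\dots,N\}$. Let $\mu_{\mathscr{G}}$ be the equilibrium measure of the correspondence $\varGamma_{\mathscr{G}}$ associated to $(S,\mathscr{G})$, and put $D:=d_1(\varGamma_{\mathscr{G}})=\sum_{j=1}^N\deg(g_j)$. For $n\in\mathbb{Z}_+$ define \[ \mu_n:=\frac{1}{D^n}\sum_{x\in \mathrm{Rep}(n;\mathscr{G})}\delta_x . \] Then $\mu_n\to\mu_{\mathscr{G}}$ in the weak-$*$ topology as $n\to\infty$.
   Context: A rational semigroup is a subsemigroup, under composition, of the holomorphic self-maps of $\mathbb{P}^1$ that contains no constant maps. A word of length $n$ is a composition $g_{j_n}\circ\cdots\circ g_{j_1}$ with $j_1,\dots,j_n\in\{1,\dots,N\}$. Distinct index sequences are regarded as distinct words, even if the resulting maps coincide. $\mathrm{Rep}(n;\mathscr{G})$ is the list obtained by running over all $N^n$ index sequences $(j_1,\dots,j_n)$ and recording every repelling fixed point of $g_{j_n}\circ\cdots\circ g_{j_1}$. A point therefore appears as many times as there are index sequences for which it is a repelling fixed point. A holomorphic correspondence on $\mathbb{P}^1$ is a formal sum $\varGamma=\sum_j m_j\Gamma_j$, where the $m_j$ are positive integers and the $\Gamma_j$ are distinct irreducible curves in $\mathbb{P}^1\times\mathbb{P}^1$. Each restricted projection $\pi_1|_{\Gamma_j}$ and $\pi_2|_{\Gamma_j}$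 is required to be surjective. The associated correspondence is $\varGamma_{\mathscr{G}}=\sum_{j=1}^N\mathrm{graph}(g_j)$, where repeated graphs are added with multiplicity. Degrees and iterates: - $d_1(\varGamma)=\sum_j m_j\deg(\pi_2|_{\Gamma_j})$, the generic number of preimages counted with multiplicity. - $d_0(\varGamma)=\sum_j m_j\deg(\pi_1|_{\Gamma_j})$. - For $\varGamma_{\mathscr{G}}$ one has $d_1=\sum_j\deg g_j$ and $d_0=N$. - The $n$-fold iterate is $\varGamma_{\mathscr{G}}^{\circ n}=\sum_{(j_1,\dots,j_n)}\mathrm{graph}(g_{j_n}\circ\cdots\circ g_{j_1})$. Pull-back of a Dirac mass: for a correspondence $\varGamma$ and $w\in\mathbb{P}^1$, $F_\varGamma^*(\delta_w)$ is the measure defined by $\langle F_\varGamma^*(\delta_w),\varphi\rangle=\sum_j m_j\sum_{z:(z,w)\in\Gamma_j}\varphi(z)$ for generic $w$, and by continuous extension in $w$ for all $w$. (For $\varGamma_{\mathscr{G}}^{\circ n}$ this means summing $\varphi$ over all $z$ with $g_{j_n}\circ\cdots\circ g_{j_1}(z)=w$, counted with local degree, over all index sequences.) Equilibrium measure: when $d_1(\varGamma)>d_0(\varGamma)$, there is a polar set $\mathcal{E}\subsetneq\mathbb{P}^1$ and a Borel probability measure $\mu_\varGamma$ such that $d_1(\varGamma)^{-n}F^*_{\varGamma^{\circ n}}(\delta_w)\to\mu_\varGamma$ weak-$*$ for all $w\notin\mathcal{E}$. This $\mu_\varGamma$ is the equilibrium measure; it charges no polar set. Here $\mu_{\mathscr{G}}:=\mu_{\varGamma_{\mathscr{G}}}$.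 *)

theory Defs
  imports "HOL-Analysis.Analysis" "HOL-Computational_Algebra.Polynomial"
begin

text \<open>P^1 is modelled as complex option: Some z is the finite point z, None is infinity.\<close>
type_synonym p1 = "complex option"

definition p1_continuous :: "(p1 \<Rightarrow> real) \<Rightarrow> bool" where
  "p1_continuous \<phi> \<longleftrightarrow>
     continuous_on UNIV (\<lambda>z. \<phi> (Some z)) \<and> ((\<lambda>z. \<phi> (Some z)) \<longlongrightarrow> \<phi> None) at_infinity"

definition p1_borel :: "p1 measure" where
  "p1_borel = sigma UNIV {A. Some -` A \<in> sets borel}"

definition rat_eval :: "complex poly \<Rightarrow> complex poly \<Rightarrow> p1 \<Rightarrow> p1" where
  "rat_eval p q x = (case x of
      Some z \<Rightarrow> (if poly q z = 0 then None else Some (poly p z / poly q z))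
    | None \<Rightarrow> (if degree q < degree p then None
               else if degree p = degree q then Some (lead_coeff p / lead_coeff q)
               else Some 0))"

definition rat_rep :: "complex poly \<Rightarrow> complex poly \<Rightarrow> (p1 \<Rightarrow> p1) \<Rightarrow> bool" where
  "rat_rep p q f \<longleftrightarrow> q \<noteq> 0 \<and> coprime p q \<and> 1 \<le> max (degree p) (degree q) \<and> f = rat_eval p q"

definition nonconst_holo_selfmap :: "(p1 \<Rightarrow> p1) \<Rightarrow> bool" where
  "nonconst_holo_selfmap f \<longleftrightarrow> (\<exists>p q. rat_rep p q f)"

definition rat_pq :: "(p1 \<Rightarrow> p1) \<Rightarrow> complex poly \<times> complex poly" where
  "rat_pq f = (SOME pq. rat_rep (fst pq) (snd pq) f)"

definition rat_deg :: "(p1 \<Rightarrow> p1) \<Rightarrow> nat" where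
  "rat_deg f = max (degree (fst (rat_pq f))) (degree (snd (rat_pq f)))"

text \<open>Multiplicity (local degree) of z as a preimage of w under f; 0 if f z \<noteq> w.\<close>
definition preimage_mult :: "(p1 \<Rightarrow> p1) \<Rightarrow> p1 \<Rightarrow> p1 \<Rightarrow> nat" where
  "preimage_mult f w z =
     (let p = fst (rat_pq f); q = snd (rat_pq f); d = rat_deg f;
          R = (case w of None \<Rightarrow> q | Some c \<Rightarrow> p - smult c q)
      in case z of Some a \<Rightarrow> order a R | None \<Rightarrow> d - degree R)"

text \<open>Repelling fixed point: fixed point with multiplier of modulus > 1, computed in the
  standard chart z (finite points) resp. 1/z (infinity).\<close>
definition repelling_fixed :: "(p1 \<Rightarrow> p1) \<Rightarrow> p1 \<Rightarrow> bool" where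
  "repelling_fixed f x \<longleftrightarrow> f x = x \<and>
     (case x of
        Some a \<Rightarrow> (\<exists>l. ((\<lambda>z. case f (Some z) of Some y \<Rightarrow> y | None \<Rightarrow> 0)
                          has_field_derivative l) (at a) \<and> 1 < cmod l)
      | None \<Rightarrow> (\<exists>l. ((\<lambda>w. case f (if w = 0 then None else Some (1 / w)) of
                               Some y \<Rightarrow> 1 / y | None \<Rightarrow> 0)
                          has_field_derivative l) (at 0) \<and> 1 < cmod l))"

fun word :: "(nat \<Rightarrow> p1 \<Rightarrow> p1) \<Rightarrow> nat list \<Rightarrow> p1 \<Rightarrow> p1" where
  "word g [] = id"
| "word g (j # js) = word g js \<circ> g j"

definition words :: "nat \<Rightarrow> nat \<Rightarrow> nat list set" where
  "words N n = {xs. length xs = n \<and> set xs \<subseteq> {..<N}}"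

text \<open>Pairing of the n-th pull-back F^*(delta_w) of Gamma_G^n with a test function.\<close>
definition pullback_pair :: "(nat \<Rightarrow> p1 \<Rightarrow> p1) \<Rightarrow> nat \<Rightarrow> nat \<Rightarrow> p1 \<Rightarrow> (p1 \<Rightarrow> real) \<Rightarrow> real" where
  "pullback_pair g N n w \<phi> =
     (\<Sum>xs\<in>words N n. \<Sum>z\<in>{z. 0 < preimage_mult (word g xs) w z}.
         real (preimage_mult (word g xs) w z) * \<phi> z)"

definition rep_pair :: "(nat \<Rightarrow> p1 \<Rightarrow> p1) \<Rightarrow> nat \<Rightarrow> nat \<Rightarrow> (p1 \<Rightarrow> real) \<Rightarrow> real" where
  "rep_pair g N n \<phi> =
     (\<Sum>xs\<in>words N n. \<Sum>x\<in>{x. repelling_fixed (word g xs) x}. \<phi> x)"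

definition harmonic_on :: "(complex \<Rightarrow> real) \<Rightarrow> complex set \<Rightarrow> bool" where
  "harmonic_on h U \<longleftrightarrow> (\<forall>z\<in>U. \<exists>r>0. ball z r \<subseteq> U \<and>
      (\<exists>f. f holomorphic_on ball z r \<and> (\<forall>x\<in>ball z r. h x = Re (f x))))"

definition subharmonic_on :: "(complex \<Rightarrow> ereal) \<Rightarrow> complex set \<Rightarrow> bool" where
  "subharmonic_on u U \<longleftrightarrow> open U \<and> (\<forall>z\<in>U. u z \<noteq> \<infinity>) \<and>
     (\<forall>c::real. open {z\<in>U. u z < ereal c}) \<and>
     (\<forall>a r h. 0 < r \<longrightarrow> cball a r \<subseteq> U \<longrightarrow> continuous_on (cball a r) h \<longrightarrow>
        harmonic_on h (ball a r) \<longrightarrow> (\<forall>z\<in>sphere a r. u z \<le> ereal (h z)) \<longrightarrow>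
        (\<forall>z\<in>ball a r. u z \<le> ereal (h z)))"

definition polar_C :: "complex set \<Rightarrow> bool" where
  "polar_C E \<longleftrightarrow> (\<forall>a\<in>E. \<exists>r>0. \<exists>u. subharmonic_on u (ball a r) \<and>
      (\<exists>z\<in>ball a r. u z \<noteq> -\<infinity>) \<and> E \<inter> ball a r \<subseteq> {z. u z = -\<infinity>})"

definition polar_P1 :: "p1 set \<Rightarrow> bool" where
  "polar_P1 E \<longleftrightarrow> polar_C (Some -` E)"

definition total_deg :: "(nat \<Rightarrow> p1 \<Rightarrow> p1) \<Rightarrow> nat \<Rightarrow> nat" where
  "total_deg g N = (\<Sum>j<N. rat_deg (g j))"

definition is_equilibrium_measure :: "(nat \<Rightarrow> p1 \<Rightarrow> p1) \<Rightarrow> nat \<Rightarrow> p1 measure \<Rightarrow> bool" where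
  "is_equilibrium_measure g N \<mu> \<longleftrightarrow>
     emeasure \<mu> (space \<mu>) = 1 \<and> sets \<mu> = sets p1_borel \<and>
     (\<exists>E. polar_P1 E \<and> E \<noteq> UNIV \<and>
        (\<forall>w. w \<notin> E \<longrightarrow> (\<forall>\<phi>. p1_continuous \<phi> \<longrightarrow>
           (\<lambda>n. pullback_pair g N n w \<phi> / real (total_deg g N) ^ n)
             \<longlonglongrightarrow> integral\<^sup>L \<mu> \<phi>)))"

end

theory Submission
  imports Defs "HOL-Complex_Analysis.Complex_Analysis"
    "HOL-Computational_Algebra.Fundamental_Theorem_Algebra"
begin

text \<open>
  The preimages of a generic point \<open>w\<close> under words of length \<open>n\<close>
  equidistribute to \<open>\<mu>\<close>, so it suffices to attach, injectively for each word, a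
  nearby repelling fixed point to all but a small proportion of the \<open>D ^ n\<close>
  preimages. On a simply connected slit plane \<open>U\<close> of full measure avoiding the
  critical values of short words, almost all preimages are values at \<open>w\<close> of inverse
  branches defined on all of \<open>U\<close>: the images of distinct branches of one word are
  disjoint, so at each later step only boundedly many branches per word are lost, and there are
  only \<open>N ^ n\<close> words with \<open>N < D\<close>. For the same reason most branches
  omit a fixed finite grid, and then Schottky's theorem makes them nearly constant on compact
  sets. If such a branch sends \<open>w\<close> into a compact part of \<open>U\<close>, it maps a
  small disc strictly into itself, and its attracting fixed point there is a repelling fixed point
  of the word.

  The choice of \<open>U\<close> requires that \<open>\<mu>\<close> has no atoms. With
  \<open>\<lambda>\<close> minus the logarithm of the chordal distance, the sum of
  \<open>\<lambda> z a\<close> over \<open>z\<close> in the fibre of \<open>f\<close> over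
  \<open>y\<close> is at most \<open>\<lambda> y (f a)\<close> up to a constant; iterating over
  words bounds the sum of \<open>\<lambda> z a\<close> over all preimages of \<open>w\<close> by
  \<open>O(D ^ n)\<close>, provided \<open>w\<close> is not too close to the images of
  \<open>a\<close> under long words. Such \<open>w\<close> outside the polar exceptional set exist
  by the maximum principle.
\<close>

section \<open>Rational maps in homogeneous coordinates\<close>

text \<open>The point with homogeneous coordinates \<open>[x : y]\<close>. The pair (0, 0) would
  also give \<open>None\<close>, so the lemmas about \<open>p1_of\<close> that involve evaluation
  exclude it.\<close>

definition p1_of :: "complex \<Rightarrow> complex \<Rightarrow> p1" where
  "p1_of x y = (if y = 0 then None else Some (x / y))"

text \<open>The homogenisation of \<open>p\<close> to degree \<open>d\<close>. The degree is a
  separate argument because numerator and denominator of a rational map must be homogenised to the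
  larger of their two degrees.\<close>

definition hom_eval :: "complex poly \<Rightarrow> nat \<Rightarrow> complex \<Rightarrow> complex \<Rightarrow> complex" where
  "hom_eval p d x y = (\<Sum>i\<le>d. coeff p i * x ^ i * y ^ (d - i))"

text \<open>The polynomial that arises by substituting \<open>[r : s]\<close> into the
  homogenisation of \<open>p\<close>; it serves as numerator or denominator of a
  composition.\<close>

definition hom_comp :: "complex poly \<Rightarrow> nat \<Rightarrow> complex poly \<Rightarrow> complex poly \<Rightarrow> complex poly" where
  "hom_comp p d r s = (\<Sum>i\<le>d. smult (coeff p i) (r ^ i * s ^ (d - i)))"

lemma hom_eval_poly:
  assumes "degree p \<le> d" "y \<noteq> 0"
  shows "hom_eval p d x y = y ^ d * poly p (x / y)"
proof -
  have "poly p (x / y) = (\<Sum>i\<le>d. coeff p i * (x / y) ^ i)"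
    unfolding poly_altdef by (rule sum.mono_neutral_left) (use assms in \<open>auto simp: coeff_eq_0\<close>)
  then have "y ^ d * poly p (x / y) = (\<Sum>i\<le>d. y ^ d * (coeff p i * (x / y) ^ i))"
    by (simp add: sum_distrib_left)
  also have "\<dots> = hom_eval p d x y"
    unfolding hom_eval_def
  proof (rule sum.cong)
    fix i assume "i \<in> {..d}"
    then have "y ^ d = y ^ i * y ^ (d - i)" by (simp flip: power_add)
    then show "y ^ d * (coeff p i * (x / y) ^ i) = coeff p i * x ^ i * y ^ (d - i)"
      using assms(2) by (simp add: power_divide)
  qed simp
  finally show ?thesis by simp
qed

lemma hom_eval_0 [simp]: "hom_eval p d x 0 = coeff p d * x ^ d"
proof -
  have "hom_eval p d x 0 = (\<Sum>i\<le>d. if i = d then coeff p d * x ^ d else 0)"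
    unfolding hom_eval_def by (rule sum.cong) (auto simp: power_0_left)
  then show ?thesis by simp
qed

lemma poly_hom_comp: "poly (hom_comp p d r s) z = hom_eval p d (poly r z) (poly s z)"
  by (simp add: hom_comp_def hom_eval_def poly_sum mult.assoc)

lemma coeff_mult_top:
  fixes a b :: "complex poly"
  assumes "degree a \<le> m" "degree b \<le> n"
  shows "coeff (a * b) (m + n) = coeff a m * coeff b n"
proof -
  have "coeff (a * b) (m + n) = (\<Sum>i\<le>m+n. coeff a i * coeff b (m + n - i))"
    by (simp add: coeff_mult)
  also have "\<dots> = (\<Sum>i\<le>m+n. if i = m then coeff a m * coeff b n else 0)"
  proof (rule sum.cong)
    fix i show "coeff a i * coeff b (m + n - i) = (if i = m then coeff a m * coeff b n else 0)"
      using assms by (cases "i < m"; cases "i = m") (auto simp: coeff_eq_0)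
  qed simp
  finally show ?thesis by simp
qed

lemma coeff_power_top:
  fixes a :: "complex poly"
  assumes "degree a \<le> m"
  shows "coeff (a ^ i) (i * m) = coeff a m ^ i \<and> degree (a ^ i) \<le> i * m"
proof (induction i)
  case (Suc i)
  then show ?case
    using coeff_mult_top[of a m "a ^ i" "i * m"] assms degree_mult_le[of a "a ^ i"] by auto
qed simp

text \<open>The pair \<open>[coeff r e : coeff s e]\<close> is the value at infinity of the inner
  map, so these coefficients carry the value at infinity of the composition.\<close>

lemma hom_comp_top:
  assumes "degree r \<le> e" "degree s \<le> e"
  shows "coeff (hom_comp p d r s) (d * e) = hom_eval p d (coeff r e) (coeff s e)"
    and "degree (hom_comp p d r s) \<le> d * e"
proof -
  have *: "coeff (r ^ i * s ^ (d - i)) (d * e) = coeff r e ^ i * coeff s e ^ (d - i)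
     \<and> degree (r ^ i * s ^ (d - i)) \<le> d * e" if "i \<le> d" for i
  proof -
    have "i * e + (d - i) * e = d * e" using that by (simp flip: add_mult_distrib)
    then show ?thesis
      using coeff_mult_top[of "r ^ i" "i * e" "s ^ (d - i)" "(d - i) * e"]
        coeff_power_top[OF assms(1), of i] coeff_power_top[OF assms(2), of "d - i"]
        degree_mult_le[of "r ^ i" "s ^ (d - i)"] by auto
  qed
  show "coeff (hom_comp p d r s) (d * e) = hom_eval p d (coeff r e) (coeff s e)"
    unfolding hom_comp_def hom_eval_def coeff_sum
    by (rule sum.cong) (simp_all add: *)
  show "degree (hom_comp p d r s) \<le> d * e"
    unfolding hom_comp_def
    by (rule degree_sum_le) (use * degree_smult_le le_trans in \<open>auto\<close>)
qed

lemma coprime_complex_poly_iff: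
  fixes p q :: "complex poly"
  assumes "q \<noteq> 0 \<or> p \<noteq> 0"
  shows "coprime p q \<longleftrightarrow> (\<forall>z. poly p z \<noteq> 0 \<or> poly q z \<noteq> 0)"
proof
  assume c: "coprime p q"
  show "\<forall>z. poly p z \<noteq> 0 \<or> poly q z \<noteq> 0"
  proof (rule allI, rule ccontr)
    fix z assume "\<not> (poly p z \<noteq> 0 \<or> poly q z \<noteq> 0)"
    then have "[:-z, 1:] dvd p" "[:-z, 1:] dvd q" by (auto simp: poly_eq_0_iff_dvd)
    then have "is_unit [:-z, 1:]" using c not_coprimeI by blast
    then show False by (auto simp: is_unit_poly_iff)
  qed
next
  assume r: "\<forall>z. poly p z \<noteq> 0 \<or> poly q z \<noteq> 0"
  show "coprime p q"
  proof (rule coprimeI)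
    fix c assume c: "c dvd p" "c dvd q"
    then have "c \<noteq> 0" using assms by auto
    moreover have "degree c = 0"
    proof (rule ccontr)
      assume "degree c \<noteq> 0"
      then have "\<not> constant (poly c)" by (metis constant_degree)
      then obtain z where "poly c z = 0" using Fundamental_Theorem_Algebra.fundamental_theorem_of_algebra by blast
      then show False using r c by (metis dvdE mult_eq_0_iff poly_mult)
    qed
    ultimately show "is_unit c" by (simp add: is_unit_iff_degree)
  qed
qed

text \<open>In homogeneous coordinates of degree \<open>d\<close>, infinity needs no separate treatment.\<close>
lemma rat_repD:
  assumes "rat_rep p q f" "d = max (degree p) (degree q)"
  shows "1 \<le> d" "degree p \<le> d" "degree q \<le> d"
    "f (Some z) = p1_of (poly p z) (poly q z)" "f None = p1_of (coeff p d) (coeff q d)"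
    "poly p z \<noteq> 0 \<or> poly q z \<noteq> 0" "coeff p d \<noteq> 0 \<or> coeff q d \<noteq> 0"
proof -
  have q: "q \<noteq> 0" "coprime p q" "1 \<le> d" "f = rat_eval p q"
    using assms by (auto simp: rat_rep_def)
  show "1 \<le> d" "degree p \<le> d" "degree q \<le> d" using q assms(2) by auto
  show "f (Some z) = p1_of (poly p z) (poly q z)"
    by (simp add: q rat_eval_def p1_of_def)
  show "f None = p1_of (coeff p d) (coeff q d)"
  proof -
    have "degree q < degree p \<Longrightarrow> coeff q (degree p) = 0" by (simp add: coeff_eq_0)
    moreover have "degree p < degree q \<Longrightarrow> coeff p (degree q) = 0" by (simp add: coeff_eq_0)
    ultimately show ?thesis
      using q(1) assms(2) by (auto simp: q(4) rat_eval_def p1_of_def max_def)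
  qed
  show "poly p z \<noteq> 0 \<or> poly q z \<noteq> 0" using coprime_complex_poly_iff q by blast
  show "coeff p d \<noteq> 0 \<or> coeff q d \<noteq> 0"
    using assms(2) q by (metis degree_0 leading_coeff_0_iff max_def not_one_le_zero)
qed

lemma rat_repI:
  assumes "\<And>z. poly p z \<noteq> 0 \<or> poly q z \<noteq> 0" "coeff p d \<noteq> 0 \<or> coeff q d \<noteq> 0"
    "degree p \<le> d" "degree q \<le> d" "1 \<le> d"
    "\<And>z. f (Some z) = p1_of (poly p z) (poly q z)" "f None = p1_of (coeff p d) (coeff q d)"
  shows "rat_rep p q f \<and> max (degree p) (degree q) = d"
proof -
  have d: "max (degree p) (degree q) = d"
    using assms(2,3,4) le_degree by fastforce
  have cop: "coprime p q" by (subst coprime_complex_poly_iff) (use assms in auto)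
  have "q \<noteq> 0"
  proof
    assume "q = 0"
    then have "degree p = 0" using cop by (auto simp: is_unit_poly_iff)
    then show False using d \<open>q = 0\<close> assms(5) by simp
  qed
  moreover have "f = rat_eval p q"
  proof
    fix x show "f x = rat_eval p q x"
    proof (cases x)
      case (Some z)
      then show ?thesis by (simp add: assms(6) rat_eval_def p1_of_def)
    next
      case None
      have "degree q < degree p \<Longrightarrow> coeff q (degree p) = 0" by (simp add: coeff_eq_0)
      moreover have "degree p < degree q \<Longrightarrow> coeff p (degree q) = 0" by (simp add: coeff_eq_0)
      ultimately show ?thesis
        using None \<open>q \<noteq> 0\<close> d by (cases "degree p" "degree q" rule: linorder_cases)
          (auto simp: assms(7) rat_eval_def p1_of_def)
    qed
  qed
  ultimately show ?thesis using cop d assms(5) by (simp add: rat_rep_def)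
qed

text \<open>A common zero with \<open>y\<close> nonzero would give a common root of \<open>p\<close>
  and \<open>q\<close>. With \<open>y = 0\<close> both coefficients of degree \<open>d\<close> would
  vanish, although \<open>d\<close> is the larger degree.\<close>

lemma hom_eval_nonzero:
  assumes "rat_rep p q f" "d = max (degree p) (degree q)" "x \<noteq> 0 \<or> y \<noteq> 0"
  shows "hom_eval p d x y \<noteq> 0 \<or> hom_eval q d x y \<noteq> 0"
  using rat_repD[OF assms(1,2)] assms(3) by (cases "y = 0") (auto simp: hom_eval_poly)

lemma rat_rep_p1_of:
  assumes "rat_rep p q f" "d = max (degree p) (degree q)" "x \<noteq> 0 \<or> y \<noteq> 0"
  shows "f (p1_of x y) = p1_of (hom_eval p d x y) (hom_eval q d x y)"
  using rat_repD[OF assms(1,2)] assms(3)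
  by (cases "y = 0") (auto simp: hom_eval_poly p1_of_def)

text \<open>The homogenised pairs have no common zero, so substitution creates no common factor and
  no drop of degree: the degree of the composition is exactly \<open>d * e\<close>.\<close>

lemma rat_rep_comp:
  assumes f: "rat_rep p q f" "d = max (degree p) (degree q)"
    and g: "rat_rep r s g" "e = max (degree r) (degree s)"
  shows "\<exists>P Q. rat_rep P Q (f \<circ> g) \<and> max (degree P) (degree Q) = d * e"
proof (intro exI, rule rat_repI)
  note F = rat_repD[OF f] and G = rat_repD[OF g]
  show "poly (hom_comp p d r s) z \<noteq> 0 \<or> poly (hom_comp q d r s) z \<noteq> 0" for z
    using hom_eval_nonzero[OF f G(6)] by (auto simp: poly_hom_comp)
  show "coeff (hom_comp p d r s) (d * e) \<noteq> 0 \<or> coeff (hom_comp q d r s) (d * e) \<noteq> 0"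
    using hom_eval_nonzero[OF f G(7)] by (simp add: hom_comp_top G)
  show "degree (hom_comp p d r s) \<le> d * e" "degree (hom_comp q d r s) \<le> d * e"
    by (simp_all add: hom_comp_top G)
  show "1 \<le> d * e" using F(1) G(1) by simp
  show "(f \<circ> g) (Some z) = p1_of (poly (hom_comp p d r s) z) (poly (hom_comp q d r s) z)" for z
    using rat_rep_p1_of[OF f G(6)] by (simp add: poly_hom_comp G(4))
  show "(f \<circ> g) None = p1_of (coeff (hom_comp p d r s) (d * e)) (coeff (hom_comp q d r s) (d * e))"
    using rat_rep_p1_of[OF f G(7)] by (simp add: hom_comp_top G)
qed

section \<open>Simple roots and the size of generic fibres\<close>

lemma degree_eq_sum_order:
  fixes p :: "complex poly"
  assumes "p \<noteq> 0"
  shows "degree p = (\<Sum>a | poly p a = 0. order a p)"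
proof -
  have "degree p = degree (smult (lead_coeff p) (\<Prod>z | poly p z = 0. [:-z, 1:] ^ order z p))"
    by (simp only: complex_poly_decompose)
  also have "\<dots> = (\<Sum>a | poly p a = 0. order a p)"
    using assms by (simp add: degree_prod_sum_eq degree_power_eq)
  finally show ?thesis .
qed

text \<open>The multiplicities of the roots are at least 1 and add up to the degree, so there are as
  many roots as the degree exactly when every multiplicity is 1.\<close>

lemma card_roots_rsquarefree:
  fixes p :: "complex poly"
  assumes "p \<noteq> 0"
  shows "card {z. poly p z = 0} = degree p \<longleftrightarrow> rsquarefree p"
proof -
  have ord: "1 \<le> order a p" if "poly p a = 0" for a
    using that assms by (simp add: order_root)
  have fin: "finite {z. poly p z = 0}" using assms by (rule poly_roots_finite)
  show ?thesis
  proof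
    assume "rsquarefree p"
    then have "order a p = 1" if "poly p a = 0" for a
      using that by (rule rsquarefree_root_order) (use assms in auto)
    then show "card {z. poly p z = 0} = degree p"
      by (simp add: degree_eq_sum_order[OF assms])
  next
    assume c: "card {z. poly p z = 0} = degree p"
    have "(\<Sum>a | poly p a = 0. order a p - 1) = (\<Sum>a | poly p a = 0. order a p) - (\<Sum>a | poly p a = 0. 1)"
      by (rule sum_subtractf_nat) (use ord in auto)
    then have "(\<Sum>a | poly p a = 0. order a p - 1) = 0"
      using c by (simp add: degree_eq_sum_order[OF assms])
    then have "\<forall>a\<in>{z. poly p z = 0}. order a p - 1 = 0"
      by (simp only: sum_eq_0_iff[OF fin])
    then have "order a p = 1" if "poly p a = 0" for a
      using that ord[OF that] by (metis le_antisym diff_is_0_eq mem_Collect_eq)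
    then show "rsquarefree p"
      using assms by (auto simp: rsquarefree_def order_root)
  qed
qed

lemma finite_fibre_eq_roots:
  assumes "rat_rep p q f"
  shows "{z. f (Some z) = Some y} = {z. poly (p - smult y q) z = 0}"
  using rat_repD[OF assms refl] by (auto simp: p1_of_def field_simps split: if_splits)

text \<open>If it vanished, p/q would have derivative 0 on a disc, so p = c q for a constant c. As
  \<open>p\<close> and \<open>q\<close> have no common zero, both would then be constant.\<close>

lemma rat_rep_wronskian:
  assumes "rat_rep p q f"
  shows "pderiv p * q - p * pderiv q \<noteq> 0"
proof
  assume W: "pderiv p * q - p * pderiv q = 0"
  have q: "q \<noteq> 0" "1 \<le> max (degree p) (degree q)" using assms by (auto simp: rat_rep_def)
  have "open {z. poly q z \<noteq> 0}"
    by (rule open_Collect_neq) (auto intro!: continuous_intros)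
  moreover obtain z0 where "poly q z0 \<noteq> 0" using q(1) poly_all_0_iff_0 by blast
  ultimately obtain r where r: "0 < r" "ball z0 r \<subseteq> {z. poly q z \<noteq> 0}"
    by (auto simp: open_contains_ball)
  have "((\<lambda>z. poly p z / poly q z) has_field_derivative 0) (at z within ball z0 r)"
    if "z \<in> ball z0 r" for z
  proof -
    have "poly q z \<noteq> 0" using r that by auto
    moreover have "poly (pderiv p * q - p * pderiv q) z = 0" by (simp add: W)
    then have "poly (pderiv p) z * poly q z - poly p z * poly (pderiv q) z = 0" by simp
    ultimately show ?thesis
      by (auto intro!: derivative_eq_intros)
  qed
  then have "\<exists>c. \<forall>z\<in>ball z0 r. poly p z / poly q z = c"
    by (intro has_field_derivative_zero_constant convex_ball)
  then obtain c where c: "\<And>z. z \<in> ball z0 r \<Longrightarrow> poly p z / poly q z = c"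
    by blast
  have "p - smult c q = 0"
  proof (rule ccontr)
    assume "p - smult c q \<noteq> 0"
    then have "finite {z. poly (p - smult c q) z = 0}" by (rule poly_roots_finite)
    moreover have "ball z0 r \<subseteq> {z. poly (p - smult c q) z = 0}"
    proof
      fix z assume z: "z \<in> ball z0 r"
      then have "poly q z \<noteq> 0" using r(2) by blast
      with c[OF z] show "z \<in> {z. poly (p - smult c q) z = 0}" by auto
    qed
    ultimately have "finite (ball z0 r)" by (rule rev_finite_subset)
    then show False using r(1) uncountable_ball[of r z0] by (simp add: countable_finite)
  qed
  then have p: "p = smult c q" by simp
  have "poly q z \<noteq> 0" for z using rat_repD(6)[OF assms refl, of z] p by auto
  then have "degree q = 0"
    using Fundamental_Theorem_Algebra.fundamental_theorem_of_algebra[of q] constant_degree[of q] by blast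
  then show False using q(2) p degree_smult_le[of c q] by simp
qed

text \<open>The polynomial p - y q has fewer than \<open>d\<close> distinct roots only if its degree
  drops, which happens for y = f(\<infinity>), or if it has a double root. A double root is a zero
  of the Wronskian, and \<open>y\<close> is the value of f there.\<close>

lemma finite_exceptional_values:
  assumes "rat_rep p q f" "d = max (degree p) (degree q)"
  shows "finite {y. card {z. f (Some z) = Some y} \<noteq> d}"
proof (rule finite_subset)
  note F = rat_repD[OF assms]
  let ?W = "pderiv p * q - p * pderiv q"
  \<comment> \<open>If f(\<infinity>) = \<infinity>, division by zero makes the last point 0, which
    merely enlarges the finite set; the degree does not drop for any finite \<open>y\<close> in that
    case.\<close>
  let ?B = "(\<lambda>z. poly p z / poly q z) ` {z. poly ?W z = 0} \<union> {coeff p d / coeff q d}"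
  show "finite ?B" 
    by (intro finite_UnI finite_imageI poly_roots_finite rat_rep_wronskian[OF assms(1)]) simp
  show "{y. card {z. f (Some z) = Some y} \<noteq> d} \<subseteq> ?B"
  proof (rule subsetI, rule ccontr)
    fix y assume y: "y \<in> {y. card {z. f (Some z) = Some y} \<noteq> d}" "y \<notin> ?B"
    let ?R = "p - smult y q"
    have c: "coeff ?R d \<noteq> 0" using y(2) F(7) by (cases "coeff q d = 0") (auto simp: field_simps)
    have "degree ?R \<le> d" using F(2,3) by (meson degree_diff_le degree_smult_le le_trans)
    then have "degree ?R = d" using c le_degree by (metis le_antisym)
    moreover have "?R \<noteq> 0" using c by auto
    moreover have "rsquarefree ?R"
      unfolding rsquarefree_roots
    proof (rule allI, rule notI)
      fix a assume "poly ?R a = 0 \<and> poly (pderiv ?R) a = 0"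
      then have a: "poly p a = y * poly q a" "poly (pderiv p) a = y * poly (pderiv q) a"
        by (auto simp: pderiv_diff pderiv_smult)
      then have "poly q a \<noteq> 0" "poly ?W a = 0" using F(6)[of a] by auto
      then have "y = poly p a / poly q a" using a(1) by (simp add: field_simps)
      then show False using y(2) \<open>poly ?W a = 0\<close> by blast
    qed
    ultimately show False
      using y(1) card_roots_rsquarefree[of ?R] finite_fibre_eq_roots[OF assms(1), of y] by auto
  qed
qed

text \<open>The degree is the size of all but finitely many fibres, hence determined by the map.
  This makes \<open>rat_deg\<close> independent of the representation chosen in
  \<open>rat_pq\<close>.\<close>

lemma rat_rep_degree_unique:
  assumes "rat_rep p q f" "rat_rep p' q' f"
  shows "max (degree p) (degree q) = max (degree p') (degree q')"
proof (rule ccontr)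
  assume ne: "\<not> ?thesis"
  have "(UNIV :: complex set) = {y. card {z. f (Some z) = Some y} \<noteq> max (degree p) (degree q)}
      \<union> {y. card {z. f (Some z) = Some y} \<noteq> max (degree p') (degree q')}"
    using ne by auto
  then have "finite (UNIV :: complex set)"
    using finite_exceptional_values[OF assms(1) refl] finite_exceptional_values[OF assms(2) refl]
    by (metis finite_UnI)
  then show False using infinite_UNIV_char_0 by blast
qed

lemma rat_rep_pq:
  assumes "nonconst_holo_selfmap f"
  shows "rat_rep (fst (rat_pq f)) (snd (rat_pq f)) f"
proof -
  obtain p q where "rat_rep p q f" using assms by (auto simp: nonconst_holo_selfmap_def)
  then have "rat_rep (fst (p, q)) (snd (p, q)) f" by simp
  then show ?thesis unfolding rat_pq_def by (rule someI)
qed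

lemma rat_deg_eq:
  assumes "rat_rep p q f"
  shows "rat_deg f = max (degree p) (degree q)"
proof -
  have "nonconst_holo_selfmap f" using assms by (auto simp: nonconst_holo_selfmap_def)
  from rat_rep_pq[OF this] assms show ?thesis
    unfolding rat_deg_def by (rule rat_rep_degree_unique)
qed

lemma rat_deg_comp:
  assumes "nonconst_holo_selfmap f" "nonconst_holo_selfmap g"
  shows "nonconst_holo_selfmap (f \<circ> g)" "rat_deg (f \<circ> g) = rat_deg f * rat_deg g"
proof -
  obtain P Q where "rat_rep P Q (f \<circ> g)" "max (degree P) (degree Q) = rat_deg f * rat_deg g"
    using rat_rep_comp[OF rat_rep_pq[OF assms(1)] refl rat_rep_pq[OF assms(2)] refl]
    unfolding rat_deg_def by blast
  then show "nonconst_holo_selfmap (f \<circ> g)" "rat_deg (f \<circ> g) = rat_deg f * rat_deg g"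
    using rat_deg_eq by (auto simp: nonconst_holo_selfmap_def)
qed

lemma rat_rep_id: "rat_rep [:0, 1:] 1 id"
  using rat_repI[of "[:0, 1:]" 1 1 id] by (simp add: p1_of_def)

lemma nonconst_word:
  assumes "\<And>j. j < N \<Longrightarrow> nonconst_holo_selfmap (g j)" "set xs \<subseteq> {..<N}"
  shows "nonconst_holo_selfmap (word g xs) \<and> rat_deg (word g xs) = (\<Prod>j\<leftarrow>xs. rat_deg (g j))"
  using assms(2)
proof (induction xs)
  case Nil
  show ?case using rat_rep_id rat_deg_eq[OF rat_rep_id] by (auto simp: nonconst_holo_selfmap_def simp del: id_apply)
next
  case (Cons j js)
  then show ?case using rat_deg_comp[of "word g js" "g j"] assms(1) by (auto simp del: comp_apply simp: mult.commute)
qed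

section \<open>Words and generic fibres\<close>

text \<open>As many finite preimages as the degree leave no room for multiple roots, nor for
  infinity, whose multiplicity is the drop in degree of p - w q.\<close>

lemma preimage_mult_simple:
  assumes f: "nonconst_holo_selfmap f" and c: "card {z. f (Some z) = Some w} = rat_deg f"
  shows "preimage_mult f (Some w) x =
    (case x of None \<Rightarrow> 0 | Some a \<Rightarrow> if f (Some a) = Some w then 1 else 0)"
proof -
  define p q R where "p = fst (rat_pq f)" and "q = snd (rat_pq f)" and "R = p - smult w q"
  have rep: "rat_rep p q f" using rat_rep_pq[OF f] by (simp add: p_def q_def)
  have d: "rat_deg f = max (degree p) (degree q)" by (rule rat_deg_eq[OF rep])
  note F = rat_repD[OF rep d]
  have roots: "{z. f (Some z) = Some w} = {z. poly R z = 0}"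
    unfolding R_def by (rule finite_fibre_eq_roots[OF rep])
  have "R \<noteq> 0"
  proof
    assume "R = 0"
    then have "{z. poly R z = 0} = UNIV" by simp
    then show False using c roots F(1) infinite_UNIV_char_0[where 'a=complex] by simp
  qed
  have "degree R \<le> rat_deg f" unfolding R_def using F(2,3)
    by (meson degree_diff_le degree_smult_le le_trans)
  then have deg: "card {z. poly R z = 0} = degree R" "degree R = rat_deg f"
    using card_poly_roots_bound[OF \<open>R \<noteq> 0\<close>] c roots by auto
  have "rsquarefree R" using deg card_roots_rsquarefree[OF \<open>R \<noteq> 0\<close>] by simp
  then have "order a R = (if poly R a = 0 then 1 else 0)" for a
    using \<open>R \<noteq> 0\<close> by (auto simp: rsquarefree_root_order order_eq_0_iff)
  moreover have "poly R a = 0 \<longleftrightarrow> f (Some a) = Some w" for a using roots by auto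
  ultimately show ?thesis
    using deg(2) by (auto simp: preimage_mult_def Let_def R_def p_def q_def split: option.splits)
qed

text \<open>Finite fixed points are roots of p - z q, of degree at most d + 1, and infinity may be
  one more. If this polynomial vanishes, the map is the identity, whose multiplier is 1
  everywhere.\<close>

lemma finite_repelling_fixed:
  assumes f: "nonconst_holo_selfmap f"
  shows "finite {x. repelling_fixed f x}" "card {x. repelling_fixed f x} \<le> rat_deg f + 2"
proof -
  define p q where "p = fst (rat_pq f)" and "q = snd (rat_pq f)"
  have rep: "rat_rep p q f" using rat_rep_pq[OF f] by (simp add: p_def q_def)
  have d: "rat_deg f = max (degree p) (degree q)" by (rule rat_deg_eq[OF rep])
  note F = rat_repD[OF rep d]
  define R where "R = p - pCons 0 q"
  have R: "poly R z = poly p z - z * poly q z" for z by (simp add: R_def)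
  have fixed: "poly R z = 0" if "f (Some z) = Some z" for z
    using that F(4)[of z] by (auto simp: p1_of_def R field_simps split: if_splits)
  have "finite {x. repelling_fixed f x} \<and> card {x. repelling_fixed f x} \<le> rat_deg f + 2"
  proof (cases "R = 0")
    case True
    \<comment> \<open>A zero of \<open>q\<close> would now also be a zero of \<open>p\<close>. Hence
      \<open>q\<close> has no zero, is constant, and the map is the identity.\<close>
    then have p: "p = pCons 0 q" by (simp add: R_def)
    have qz: "poly q z \<noteq> 0" for z using F(6)[of z] by (auto simp: p)
    then have "f (Some z) = Some z" for z using F(4)[of z] by (simp add: p1_of_def p)
    moreover have "degree q = 0"
      using qz Fundamental_Theorem_Algebra.fundamental_theorem_of_algebra[of q] constant_degree[of q] by blast
    then have "f None = None"
      using F(1,5) rep by (auto simp: p d p1_of_def degree_pCons_eq_if rat_rep_def coeff_eq_0 split: if_splits)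
    ultimately have id: "f = id" by (metis id_apply not_None_eq ext)
    have "\<not> repelling_fixed f x" for x
    proof (cases x)
      case None
      have *: "(\<lambda>w. case f (if w = 0 then None else Some (1 / w)) of Some y \<Rightarrow> 1 / y | None \<Rightarrow> 0) = (\<lambda>w. w)"
        by (auto simp: id)
      show ?thesis unfolding repelling_fixed_def None option.case *
        using DERIV_unique[OF DERIV_ident] by fastforce
    next
      case (Some a)
      have *: "(\<lambda>z. case f (Some z) of Some y \<Rightarrow> y | None \<Rightarrow> 0) = (\<lambda>w. w)"
        by (auto simp: id)
      show ?thesis unfolding repelling_fixed_def Some option.case *
        using DERIV_unique[OF DERIV_ident] by fastforce
    qed
    then show ?thesis by simp
  next
    case False
    have "degree R \<le> rat_deg f + 1"
      unfolding R_def using F(2,3) by (intro degree_diff_le) (auto simp: degree_pCons_eq_if)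
    then have "card {z. poly R z = 0} \<le> rat_deg f + 1"
      using card_poly_roots_bound[OF False] by simp
    then have "card (insert None (Some ` {z. poly R z = 0})) \<le> rat_deg f + 2"
      using poly_roots_finite[OF False] by (simp add: card_insert_if card_image)
    moreover have "finite (insert None (Some ` {z. poly R z = 0}))"
      using poly_roots_finite[OF False] by simp
    moreover have "x \<in> insert None (Some ` {z. poly R z = 0})" if "repelling_fixed f x" for x
      using that fixed by (cases x) (auto simp: repelling_fixed_def)
    then have "{x. repelling_fixed f x} \<subseteq> insert None (Some ` {z. poly R z = 0})"
      by blast
    ultimately show ?thesis by (meson card_mono finite_subset le_trans)
  qed
  then show "finite {x. repelling_fixed f x}" "card {x. repelling_fixed f x} \<le> rat_deg f + 2"
    by auto
qed

section \<open>Sums over words and over fibres of generic points\<close>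

lemma finite_words [simp]: "finite (words N n)"
  and card_words: "card (words N n) = N ^ n"
proof -
  have "words N n = {xs. set xs \<subseteq> {..<N} \<and> length xs = n}" by (auto simp: words_def)
  then show "finite (words N n)" "card (words N n) = N ^ n"
    by (simp_all add: finite_lists_length_eq card_lists_length_eq)
qed

lemma words_0 [simp]: "words N 0 = {[]}"
  by (auto simp: words_def)

lemma sum_words_Suc:
  "(\<Sum>xs\<in>words N (Suc n). F xs) = (\<Sum>j<N. \<Sum>js\<in>words N n. F (j # js))"
proof -
  have "words N (Suc n) = (\<lambda>(j, js). j # js) ` ({..<N} \<times> words N n)"
    by (auto simp: words_def length_Suc_conv image_iff)
  moreover have "inj_on (\<lambda>(j, js). j # js) ({..<N} \<times> words N n)"
    by (auto simp: inj_on_def)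
  ultimately show ?thesis
    by (simp add: sum.reindex sum.cartesian_product case_prod_unfold)
qed

locale rational_generators =
  fixes g :: "nat \<Rightarrow> p1 \<Rightarrow> p1" and N :: nat
  assumes nonconst: "j < N \<Longrightarrow> nonconst_holo_selfmap (g j)"
    and deg2: "\<exists>j<N. 2 \<le> rat_deg (g j)"
begin

abbreviation D :: real where "D \<equiv> real (total_deg g N)"

text \<open>The finite points with fewer than \<open>rat_deg (g j)\<close> finite preimages: critical values and \<open>g j None\<close>.\<close>
definition exc_vals :: "nat \<Rightarrow> complex set" where
  "exc_vals j = {y. card {z. g j (Some z) = Some y} \<noteq> rat_deg (g j)}"

definition fib :: "nat list \<Rightarrow> complex \<Rightarrow> complex set" where
  "fib xs w = {z. word g xs (Some z) = Some w}"

text \<open>No forward image of infinity or of an exceptional value is \<open>w\<close>. Hence the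
  whole backward orbit of \<open>w\<close> stays finite, and at each of its points every generator
  has the full number of simple finite preimages.\<close>

definition generic :: "complex \<Rightarrow> bool" where
  "generic w \<longleftrightarrow> (\<forall>js. set js \<subseteq> {..<N} \<longrightarrow> word g js None \<noteq> Some w \<and>
     (\<forall>j<N. \<forall>v\<in>exc_vals j. word g js (Some v) \<noteq> Some w))"

lemma deg_pos: "j < N \<Longrightarrow> 1 \<le> rat_deg (g j)"
  using rat_repD(1)[OF rat_rep_pq[OF nonconst] refl] rat_deg_eq[OF rat_rep_pq[OF nonconst]] by simp

lemma N_pos: "0 < N" using deg2 by auto

text \<open>The generator of degree at least 2 makes the inequality strict. Because of this gap, any
  loss bounded per word is negligible: there are \<open>N ^ n\<close> words but \<open>D ^ n\<close>
  preimages.\<close>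

lemma N_less_D: "real N < D"
proof -
  obtain k where k: "k < N" "2 \<le> rat_deg (g k)" using deg2 by blast
  have "(\<Sum>j<N. 1) < (\<Sum>j<N. rat_deg (g j))"
    by (rule sum_strict_mono_ex1) (use k deg_pos in force)+
  then have "N < total_deg g N" by (simp add: total_deg_def)
  then show ?thesis by (rule of_nat_less_iff[THEN iffD2])
qed

lemma D_pos: "0 < D" using N_less_D N_pos by linarith

lemma finite_exc_vals: "j < N \<Longrightarrow> finite (exc_vals j)"
  unfolding exc_vals_def using rat_deg_eq[OF rat_rep_pq[OF nonconst]]
  by (intro finite_exceptional_values[OF rat_rep_pq[OF nonconst]]) auto

lemma finite_fibre:
  assumes "j < N" "y \<notin> exc_vals j"
  shows "finite {z. g j (Some z) = Some y}" "card {z. g j (Some z) = Some y} = rat_deg (g j)"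
proof -
  show "card {z. g j (Some z) = Some y} = rat_deg (g j)" using assms by (simp add: exc_vals_def)
  then show "finite {z. g j (Some z) = Some y}"
    using deg_pos[OF assms(1)] by (metis card.infinite not_one_le_zero)
qed

lemma genericD:
  assumes "generic w" "set js \<subseteq> {..<N}" "j < N" "y \<in> fib js w"
  shows "y \<notin> exc_vals j"
  using assms by (auto simp: generic_def fib_def)

lemma fib_Nil [simp]: "fib [] w = {w}" by (simp add: fib_def)

text \<open>The head of a word is applied first, so prepending a letter extends the fibre one step
  further back. Genericity excludes that the intermediate point is infinity.\<close>

lemma fib_Cons:
  assumes "generic w" "set js \<subseteq> {..<N}"
  shows "fib (j # js) w = (\<Union>y\<in>fib js w. {z. g j (Some z) = Some y})"
proof -
  have "\<exists>y. g j (Some z) = Some y" if "z \<in> fib (j # js) w" for z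
    using that assms by (cases "g j (Some z)") (auto simp: fib_def generic_def)
  then show ?thesis by (fastforce simp: fib_def)
qed

lemma finite_fib: "\<lbrakk>generic w; set xs \<subseteq> {..<N}\<rbrakk> \<Longrightarrow> finite (fib xs w)"
  by (induction xs) (auto simp: fib_Cons intro!: finite_fibre dest: genericD)

lemma sum_fib_Cons:
  assumes "generic w" "set js \<subseteq> {..<N}" "j < N"
  shows "(\<Sum>z\<in>fib (j # js) w. F z) = (\<Sum>y\<in>fib js w. \<Sum>z | g j (Some z) = Some y. F z)"
  unfolding fib_Cons[OF assms(1,2)]
  by (rule sum.UNION_disjoint) (use assms finite_fib finite_fibre genericD in \<open>auto\<close>)

lemma card_fib:
  assumes "generic w" "set xs \<subseteq> {..<N}"
  shows "card (fib xs w) = (\<Prod>j\<leftarrow>xs. rat_deg (g j))"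
  using assms(2)
proof (induction xs)
  case (Cons j js)
  then have "(\<Sum>z\<in>fib (j # js) w. 1) = (\<Sum>y\<in>fib js w. rat_deg (g j))"
    using finite_fibre(2) genericD[OF assms(1)] by (subst sum_fib_Cons[OF assms(1)]) (auto intro: sum.cong)
  then show ?case using Cons by simp
qed simp

lemma sum_deg_words: "(\<Sum>xs\<in>words N n. \<Prod>j\<leftarrow>xs. rat_deg (g j)) = total_deg g N ^ n"
proof (induction n)
  case (Suc n)
  then show ?case
    by (simp add: sum_words_Suc total_deg_def sum_distrib_right flip: sum_distrib_left)
qed simp

lemma sum_card_fib:
  assumes "generic w"
  shows "(\<Sum>xs\<in>words N n. real (card (fib xs w))) = D ^ n"
proof -
  have "(\<Sum>xs\<in>words N n. card (fib xs w)) = (\<Sum>xs\<in>words N n. \<Prod>j\<leftarrow>xs. rat_deg (g j))"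
    by (rule sum.cong) (auto simp: card_fib[OF assms] words_def)
  then show ?thesis by (metis sum_deg_words of_nat_power of_nat_sum)
qed

text \<open>Over a generic point infinity is never a preimage and all multiplicities are 1.\<close>

lemma pullback_pair_generic:
  assumes "generic w"
  shows "pullback_pair g N n (Some w) \<phi> = (\<Sum>xs\<in>words N n. \<Sum>z\<in>fib xs w. \<phi> (Some z))"
  unfolding pullback_pair_def
proof (rule sum.cong)
  fix xs assume "xs \<in> words N n"
  then have xs: "set xs \<subseteq> {..<N}" by (auto simp: words_def)
  have f: "nonconst_holo_selfmap (word g xs)" "rat_deg (word g xs) = card (fib xs w)"
    using nonconst_word[OF nonconst xs] card_fib[OF assms xs] by auto
  have m: "preimage_mult (word g xs) (Some w) x =
      (case x of None \<Rightarrow> 0 | Some a \<Rightarrow> if a \<in> fib xs w then 1 else 0)" for x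
    using preimage_mult_simple[OF f(1), of w x] f(2) by (auto simp: fib_def split: option.splits)
  have "{z. 0 < preimage_mult (word g xs) (Some w) z} = Some ` fib xs w"
    by (auto simp: m split: option.splits if_splits)
  then show "(\<Sum>z | 0 < preimage_mult (word g xs) (Some w) z.
      real (preimage_mult (word g xs) (Some w) z) * \<phi> z) = (\<Sum>z\<in>fib xs w. \<phi> (Some z))"
    by (simp add: sum.reindex m)
qed simp

lemma countable_not_generic: "countable {w. \<not> generic w}"
proof (rule countable_subset)
  let ?B = "\<Union>js::nat list. set_option (word g js None) \<union> (\<Union>j\<in>{..<N}. \<Union>v\<in>exc_vals j. set_option (word g js (Some v)))"
  show "{w. \<not> generic w} \<subseteq> ?B"
    by (auto simp: generic_def)
  show "countable ?B"
    using finite_exc_vals by (intro countable_UN countable_Un) (auto intro: countable_finite)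
qed

text \<open>The excess over the degree is at most 2 for each of the \<open>N ^ n\<close>
  words.\<close>

lemma rep_card_le:
  "(\<Sum>xs\<in>words N n. real (card {x. repelling_fixed (word g xs) x})) \<le> D ^ n + 2 * real N ^ n"
proof -
  have "card {x. repelling_fixed (word g xs) x} \<le> (\<Prod>j\<leftarrow>xs. rat_deg (g j)) + 2"
    if "xs \<in> words N n" for xs
    using that finite_repelling_fixed(2) nonconst_word[OF nonconst] by (fastforce simp: words_def)
  then have "(\<Sum>xs\<in>words N n. card {x. repelling_fixed (word g xs) x})
      \<le> (\<Sum>xs\<in>words N n. (\<Prod>j\<leftarrow>xs. rat_deg (g j)) + 2)"
    by (rule sum_mono)
  also have "\<dots> = total_deg g N ^ n + 2 * N ^ n"
    by (simp only: sum.distrib sum_deg_words) (simp add: card_words)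
  finally have "real (\<Sum>xs\<in>words N n. card {x. repelling_fixed (word g xs) x}) \<le> real (total_deg g N ^ n + 2 * N ^ n)"
    by (simp only: of_nat_le_iff)
  then show ?thesis by simp
qed

end

section \<open>Avoiding polar sets\<close>

text \<open>If a polar set contained all points with \<open>P\<close>, it would contain arbitrarily small circles about
  every point, and the maximum principle would make the subharmonic function identically \<open>-\<infinity>\<close>.\<close>
lemma polar_avoid:
  assumes E: "polar_C E" and P: "\<And>z0. AE s in lborel. \<forall>w. dist z0 w = s \<longrightarrow> P w"
  shows "\<exists>w. w \<notin> E \<and> P w"
proof (rule ccontr)
  assume "\<not> ?thesis"
  then have PE: "w \<in> E" if "P w" for w using that by blast
  have radius: "\<exists>s. 0 < s \<and> s < r \<and> (\<forall>w. dist z0 w = s \<longrightarrow> P w)" if "0 < r" for z0 and r :: real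
  proof (rule ccontr)
    assume no: "\<not> ?thesis"
    have "AE s in lborel. s \<notin> {0<..<r}"
      using P[of z0] by eventually_elim (use no in auto)
    then have "{0<..<r} \<in> null_sets lborel"
      by (subst (asm) AE_iff_null_sets[symmetric]) auto
    then have "emeasure lborel {0<..<r} = 0" by (rule null_setsD1)
    then show False using that by simp
  qed
  \<comment> \<open>The first circle, about 0, only serves to find a point of \<open>E\<close> and
    with it a local subharmonic function \<open>u\<close>. The second circle is centred at a point
    \<open>z\<close> where \<open>u\<close> is not -\<infinity>.\<close>
  obtain s where s: "0 < s" "\<forall>w. dist 0 w = s \<longrightarrow> P w" using radius[of 1 0] by auto
  then have "complex_of_real s \<in> E" using PE by simp
  then obtain r u where "0 < r" and u: "subharmonic_on u (ball (complex_of_real s) r)"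
    "\<exists>z\<in>ball (complex_of_real s) r. u z \<noteq> - \<infinity>"
    "E \<inter> ball (complex_of_real s) r \<subseteq> {z. u z = -\<infinity>}"
    using E unfolding polar_C_def by meson
  let ?a = "complex_of_real s"
  obtain z where z: "z \<in> ball ?a r" "u z \<noteq> -\<infinity>" using u(2) by blast
  have "0 < r - dist ?a z" using z(1) by simp
  then obtain t where t: "0 < t" "t < r - dist ?a z" "\<forall>w. dist z w = t \<longrightarrow> P w"
    using radius by meson
  have sub: "cball z t \<subseteq> ball ?a r"
  proof
    fix w assume "w \<in> cball z t"
    then show "w \<in> ball ?a r" using t(2) dist_triangle[of ?a w z] by simp
  qed
  have bdry: "u w = -\<infinity>" if "w \<in> sphere z t" for w
  proof -
    have "w \<in> E" using that t(3) PE by simp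
    moreover have "w \<in> ball ?a r" using that sub by auto
    ultimately show ?thesis using u(3) by blast
  qed
  \<comment> \<open>On the circle \<open>u\<close> is -\<infinity>, so every constant
    \<open>L\<close> is a harmonic majorant there and bounds \<open>u z\<close> as well.\<close>
  have "u z \<le> ereal L" for L
  proof -
    have "harmonic_on (\<lambda>_. L) (ball z t)"
      unfolding harmonic_on_def
    proof
      fix w assume "w \<in> ball z t"
      then obtain e where "0 < e" "ball w e \<subseteq> ball z t" using open_ball openE by blast
      then show "\<exists>r>0. ball w r \<subseteq> ball z t \<and> (\<exists>f. f holomorphic_on ball w r \<and> (\<forall>x\<in>ball w r. L = Re (f x)))"
        by (intro exI[of _ e] conjI exI[of _ "\<lambda>_. complex_of_real L"]) auto
    qed
    moreover have "\<forall>a \<rho> h. 0 < \<rho> \<longrightarrow> cball a \<rho> \<subseteq> ball ?a r \<longrightarrow> continuous_on (cball a \<rho>) h \<longrightarrow>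
        harmonic_on h (ball a \<rho>) \<longrightarrow> (\<forall>z\<in>sphere a \<rho>. u z \<le> ereal (h z)) \<longrightarrow>
        (\<forall>z\<in>ball a \<rho>. u z \<le> ereal (h z))"
      using u(1) unfolding subharmonic_on_def by (elim conjE)
    note this[rule_format, of t z "\<lambda>_. L" z]
    ultimately show ?thesis using t(1) sub bdry by simp
  qed
  then show False using z(2) ereal_bot by blast
qed

text \<open>The distances from \<open>z0\<close> to a countable set form a countable set of radii.
  The statement concerns whole circles because \<open>polar_avoid\<close> requires this
  form.\<close>

lemma AE_radius_countable:
  assumes "countable (B :: complex set)"
  shows "AE s in lborel. \<forall>w. dist z0 w = s \<longrightarrow> w \<notin> B"
proof -
  have "dist z0 ` B \<in> null_sets lborel"
    using assms by (intro countable_imp_null_set_lborel) simp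
  from AE_not_in[OF this] show ?thesis by eventually_elim auto
qed

text \<open>A circle of radius \<open>s\<close> that comes too close to \<open>B n\<close> has
  \<open>s\<close> in a union of at most \<open>N ^ n\<close> intervals of length 2 / (2N)^n. The
  total length is at most 2 / 2^n, which is summable, and the Borel-Cantelli lemma applies.\<close>

lemma AE_radius_far:
  fixes B :: "nat \<Rightarrow> complex set"
  assumes B: "\<And>n. finite (B n)" "\<And>n. card (B n) \<le> N ^ n" and N: "0 < N"
  shows "AE s in lborel. \<forall>w. dist z0 w = s \<longrightarrow>
    (\<forall>\<^sub>F n in sequentially. \<forall>v\<in>B n. (1 / (2 * real N)) ^ n \<le> dist w v)"
proof -
  define r where "r n = (1 / (2 * real N)) ^ n" for n
  have r: "0 \<le> r n" for n by (simp add: r_def)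
  define A where "A n = (\<Union>v\<in>B n. ball (dist z0 v) (r n))" for n
  have A_le: "emeasure lborel (A n) \<le> ennreal (2 * (1 / 2) ^ n)" for n
  proof -
    have "emeasure lborel (A n) \<le> (\<Sum>v\<in>B n. emeasure lborel (ball (dist z0 v) (r n)))"
      unfolding A_def by (rule emeasure_subadditive_finite) (use B in auto)
    also have "\<dots> = (\<Sum>v\<in>B n. ennreal (2 * r n))"
      using r by (intro sum.cong) (auto simp: ball_eq_greaterThanLessThan)
    also have "\<dots> = ennreal (real (card (B n)) * (2 * r n))"
      using r by (subst sum_ennreal) auto
    also have "\<dots> \<le> ennreal (real (N ^ n) * (2 * r n))"
      using B r by (intro ennreal_leI mult_right_mono of_nat_mono) auto
    also have "real (N ^ n) * (2 * r n) = 2 * (1 / 2) ^ n"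
      using N by (simp add: r_def power_divide power_mult_distrib)
    finally show ?thesis .
  qed
  have "AE s in lborel. \<forall>\<^sub>F n in sequentially. s \<in> space lborel - A n"
  proof (rule borel_cantelli_AE1)
    show "A n \<in> sets lborel" for n unfolding A_def using B by auto
    show "emeasure lborel (A n) < \<infinity>" for n
      using le_less_trans[OF A_le] by (simp add: ennreal_less_top)
    show "summable (\<lambda>n. measure lborel (A n))"
    proof (rule summable_comparison_test')
      show "summable (\<lambda>n. 2 * (1 / 2 :: real) ^ n)"
        by (intro summable_mult summable_geometric) simp
      show "norm (measure lborel (A n)) \<le> 2 * (1 / 2) ^ n" for n
        using A_le[of n] by (simp add: measure_def enn2real_leI)
    qed
  qed
  then show ?thesis
  proof eventually_elim
    case (elim s)
    show ?case
    proof (intro allI impI)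
      fix w assume w: "dist z0 w = s"
      from elim show "\<forall>\<^sub>F n in sequentially. \<forall>v\<in>B n. (1 / (2 * real N)) ^ n \<le> dist w v"
      proof eventually_elim
        case (elim n)
        have "r n \<le> \<bar>dist z0 v - s\<bar>" if "v \<in> B n" for v
        proof -
          have "s \<notin> ball (dist z0 v) (r n)" using elim that unfolding A_def by blast
          then show ?thesis by (simp add: dist_real_def)
        qed
        moreover have "\<bar>dist z0 v - s\<bar> \<le> dist w v" for v
          using w dist_triangle[of z0 v w] dist_triangle[of z0 w v] by (simp add: dist_commute abs_le_iff)
        ultimately show ?case unfolding r_def by (meson order_trans)
      qed
    qed
  qed
qed

section \<open>Chordal distances along fibres\<close>

text \<open>A function comparable to the chordal metric, with 1 + |z| in place of the square root of
  1 + |z|^2.\<close>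

fun chord :: "p1 \<Rightarrow> p1 \<Rightarrow> real" where
  "chord (Some z) (Some b) = cmod (z - b) / ((1 + cmod z) * (1 + cmod b))"
| "chord (Some z) None = 1 / (1 + cmod z)"
| "chord None (Some b) = 1 / (1 + cmod b)"
| "chord None None = 0"

lemma one_plus_norm_pos [simp]: "0 < 1 + cmod z" "1 + cmod z \<noteq> 0"
  using norm_ge_zero[of z] by linarith+

lemma chord_nonneg: "0 \<le> chord x y"
  by (cases x; cases y) auto

lemma chord_le_1: "chord x y \<le> 1"
proof (cases x; cases y)
  fix z b assume "x = Some z" "y = Some b"
  moreover have "cmod (z - b) \<le> (1 + cmod z) * (1 + cmod b)"
    using norm_triangle_ineq4[of z b] mult_nonneg_nonneg[OF norm_ge_zero[of z] norm_ge_zero[of b]]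
    unfolding distrib_left distrib_right by linarith
  ultimately show ?thesis by (simp add: divide_le_eq)
qed auto

lemma chord_eq_0_iff: "chord x y = 0 \<longleftrightarrow> x = y"
  by (cases x; cases y) auto

lemma chord_pos: "x \<noteq> y \<Longrightarrow> 0 < chord x y"
  using chord_nonneg[of x y] chord_eq_0_iff[of x y] by linarith

lemma filterlim_one_plus_norm: "filterlim (\<lambda>z::complex. 1 + cmod z) at_top at_infinity"
  by (rule filterlim_tendsto_add_at_top[OF tendsto_const filterlim_norm_at_top])

lemma p1_continuous_chord: "p1_continuous (\<lambda>x. chord x a)"
proof (cases a)
  case None
  have "((\<lambda>z. 1 / (1 + cmod z)) \<longlongrightarrow> 0) at_infinity"
    by (rule tendsto_divide_0[OF tendsto_const])
       (rule filterlim_at_top_imp_at_infinity[OF filterlim_one_plus_norm])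
  then show ?thesis
    by (auto simp: None p1_continuous_def intro!: continuous_intros)
next
  case (Some b)
  have "((\<lambda>z. cmod (z - b) / ((1 + cmod z) * (1 + cmod b))) \<longlongrightarrow> 1 / (1 + cmod b)) at_infinity"
  proof -
    have 1: "((\<lambda>z. (1 + cmod b) / (1 + cmod z)) \<longlongrightarrow> 0) at_infinity"
      by (rule tendsto_divide_0[OF tendsto_const])
         (rule filterlim_at_top_imp_at_infinity[OF filterlim_one_plus_norm])
    have "((\<lambda>z. cmod (z - b) / (1 + cmod z) - 1) \<longlongrightarrow> 0) at_infinity"
    proof (rule Lim_null_comparison[OF _ 1], rule always_eventually, rule allI)
      fix z
      have "\<bar>cmod (z - b) - (1 + cmod z)\<bar> \<le> 1 + cmod b"
        using norm_triangle_ineq3[of "z - b" z] by (simp add: abs_le_iff)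
      then have "\<bar>(cmod (z - b) - (1 + cmod z)) / (1 + cmod z)\<bar> \<le> (1 + cmod b) / (1 + cmod z)"
        by (simp add: abs_divide divide_right_mono)
      then show "norm (cmod (z - b) / (1 + cmod z) - 1) \<le> (1 + cmod b) / (1 + cmod z)"
        by (simp add: diff_divide_distrib)
    qed
    then have "((\<lambda>z. cmod (z - b) / (1 + cmod z)) \<longlongrightarrow> 1) at_infinity"
      by (simp add: LIM_zero_iff)
    from tendsto_divide[OF this tendsto_const[of "1 + cmod b"]] show ?thesis by simp
  qed
  then show ?thesis
    by (auto simp: Some p1_continuous_def intro!: continuous_intros)
qed

text \<open>In this form the second point may be infinity without a separate case.\<close>

lemma chord_p1_of:
  assumes "x \<noteq> 0 \<or> y \<noteq> 0"
  shows "chord (Some z) (p1_of x y) = cmod (x - z * y) / ((1 + cmod z) * (cmod x + cmod y))"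
proof (cases "y = 0")
  case False
  have "chord (Some z) (p1_of x y) = (cmod (z - x / y) * cmod y) / ((1 + cmod z) * ((1 + cmod (x / y)) * cmod y))"
    using False by (simp add: p1_of_def)
  also have "cmod (z - x / y) * cmod y = cmod (x - z * y)"
    using False by (simp add: norm_minus_commute left_diff_distrib flip: norm_mult)
  also have "(1 + cmod (x / y)) * cmod y = cmod x + cmod y"
    using False by (simp add: norm_divide field_simps)
  finally show ?thesis .
qed (use assms in \<open>simp add: p1_of_def\<close>)

lemma ex_p1_of: "\<exists>x y. (x \<noteq> 0 \<or> y \<noteq> 0) \<and> a = p1_of x y"
proof (cases a)
  case None
  then show ?thesis by (intro exI[of _ 1] exI[of _ 0]) (simp add: p1_of_def)
next
  case (Some b)
  then show ?thesis by (intro exI[of _ b] exI[of _ 1]) (simp add: p1_of_def)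
qed

lemma hom_eval_scale: "hom_eval p d (t * x) (t * y) = t ^ d * hom_eval p d x y"
proof -
  have "t ^ i * t ^ (d - i) = t ^ d" if "i \<le> d" for i
    using that by (simp flip: power_add)
  then have "coeff p i * (t * x) ^ i * (t * y) ^ (d - i) = t ^ d * (coeff p i * x ^ i * y ^ (d - i))"
    if "i \<le> d" for i
    using that by (simp add: power_mult_distrib mult_ac)
  then show ?thesis unfolding hom_eval_def sum_distrib_left by (intro sum.cong) auto
qed

text \<open>The right-hand side has no zero on the compact sphere |x| + |y| = 1, so it has a
  positive minimum there; homogeneity carries the bound to all pairs.\<close>

lemma hom_eval_lower_bound:
  assumes "rat_rep p q f" "d = max (degree p) (degree q)"
  shows "\<exists>c>0. \<forall>x y. c * (cmod x + cmod y) ^ d \<le> cmod (hom_eval p d x y) + cmod (hom_eval q d x y)"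
proof -
  define S where "S = {v :: complex \<times> complex. cmod (fst v) + cmod (snd v) = 1}"
  define F where "F v = cmod (hom_eval p d (fst v) (snd v)) + cmod (hom_eval q d (fst v) (snd v))" for v
  have "closed S" unfolding S_def
    by (intro closed_Collect_eq continuous_intros)
  moreover have "bounded S"
    unfolding bounded_iff S_def
  proof (intro exI[of _ 1] ballI)
    fix v :: "complex \<times> complex" assume "v \<in> {v. cmod (fst v) + cmod (snd v) = 1}"
    then show "norm v \<le> 1" using norm_Pair_le[of "fst v" "snd v"] by simp
  qed
  ultimately have "compact S" by (simp add: compact_eq_bounded_closed)
  moreover have "(1, 0) \<in> S" by (simp add: S_def)
  moreover have "continuous_on S F"
    unfolding F_def hom_eval_def by (intro continuous_intros)
  ultimately obtain v where v: "v \<in> S" "\<And>u. u \<in> S \<Longrightarrow> F v \<le> F u"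
    using continuous_attains_inf[of S F] by blast
  have "fst v \<noteq> 0 \<or> snd v \<noteq> 0" using v(1) by (auto simp: S_def)
  then have "0 < F v" using hom_eval_nonzero[OF assms]
    unfolding F_def by (metis add_nonneg_pos add_pos_nonneg norm_ge_zero zero_less_norm_iff)
  moreover have "F v * (cmod x + cmod y) ^ d \<le> cmod (hom_eval p d x y) + cmod (hom_eval q d x y)" for x y
  proof (cases "x = 0 \<and> y = 0")
    case True
    then show ?thesis using rat_repD(1)[OF assms] by (simp add: power_0_left)
  next
    case False
    define t where "t = complex_of_real (cmod x + cmod y)"
    have pos: "0 < cmod x + cmod y" using False by (smt (verit) norm_ge_zero zero_less_norm_iff)
    have t: "t \<noteq> 0" "cmod t = cmod x + cmod y" using pos by (auto simp: t_def simp flip: of_real_add)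
    have "(x / t, y / t) \<in> S"
      using t pos by (simp add: S_def norm_divide flip: add_divide_distrib)
    then have "F v \<le> F (x / t, y / t)" by (rule v)
    moreover have "cmod (hom_eval r d x y) = cmod t ^ d * cmod (hom_eval r d (x / t) (y / t))" for r
      using hom_eval_scale[of r d t "x / t" "y / t"] t by (simp add: norm_mult norm_power)
    ultimately show ?thesis
      using mult_left_mono[of "F v" "F (x / t, y / t)" "cmod t ^ d"] t pos
      by (simp add: F_def distrib_left mult.commute)
  qed
  ultimately show ?thesis by blast
qed

text \<open>By pigeonhole, one of \<open>d + 1\<close> equidistant points of the unit interval keeps its distance
  from all \<open>d\<close> roots.\<close>
lemma leading_coeff_prod_roots_bound:
  fixes Z :: "complex set" and \<kappa> :: complex
  assumes Z: "finite Z" "card Z = d" and B: "\<And>x. cmod x \<le> 1 \<Longrightarrow> cmod (\<kappa> * (\<Prod>z\<in>Z. x - z)) \<le> B"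
  shows "cmod \<kappa> * (\<Prod>z\<in>Z. 1 + cmod z) \<le> (8 * (real d + 1)) ^ d * B"
proof -
  define pt where "pt k = complex_of_real (real k / (real d + 1))" for k
  \<comment> \<open>Half the spacing of the points \<open>pt k\<close>, so that one root cannot be
    closer than \<open>e\<close> to two of them.\<close>
  define e where "e = 1 / (2 * (real d + 1))"
  have e: "0 < e" "e \<le> 1 / 2" by (auto simp: e_def field_simps)
  have "\<exists>k\<le>d. \<forall>z\<in>Z. e \<le> cmod (pt k - z)"
  proof (rule ccontr)
    assume "\<not> ?thesis"
    then have "\<forall>k. k \<le> d \<longrightarrow> (\<exists>z\<in>Z. cmod (pt k - z) < e)" by (meson not_le)
    then obtain f where f: "\<And>k. k \<le> d \<Longrightarrow> f k \<in> Z \<and> cmod (pt k - f k) < e"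
      by metis
    have "inj_on f {..d}"
    proof (rule inj_onI, rule ccontr)
      fix k l assume kl: "k \<in> {..d}" "l \<in> {..d}" "f k = f l" "k \<noteq> l"
      then have "cmod (pt k - pt l) < 2 * e"
        using f[of k] f[of l] norm_triangle_ineq4[of "pt k - f k" "pt l - f l"] by auto
      moreover have "pt k - pt l = complex_of_real ((real k - real l) / (real d + 1))"
        by (simp add: pt_def diff_divide_distrib)
      then have "cmod (pt k - pt l) = \<bar>real k - real l\<bar> / (real d + 1)"
        by (simp only: norm_of_real) (simp add: abs_divide)
      moreover have "1 \<le> \<bar>real k - real l\<bar>" using kl(4) by linarith
      then have "2 * e \<le> \<bar>real k - real l\<bar> / (real d + 1)"
        unfolding e_def by (simp add: field_simps)
      ultimately show False by linarith
    qed
    then have "card {..d} \<le> card Z" using f Z by (intro card_inj_on_le) auto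
    then show False using Z by simp
  qed
  then obtain k where k: "k \<le> d" "\<And>z. z \<in> Z \<Longrightarrow> e \<le> cmod (pt k - z)" by blast
  have pt1: "cmod (pt k) \<le> 1" unfolding pt_def norm_of_real using k(1) by simp
  \<comment> \<open>A root of modulus at least 3 is far from the unit disc. For any other root 1 +
    |z| is below 4 = 8 (d + 1) e, which fixes the factor.\<close>
  have fac: "1 + cmod z \<le> 8 * (real d + 1) * cmod (pt k - z)" if "z \<in> Z" for z
  proof (cases "3 \<le> cmod z")
    case True
    have "cmod z - 1 \<le> cmod (pt k - z)"
      using norm_triangle_ineq2[of z "pt k"] pt1 by (simp add: norm_minus_commute)
    then have "1 + cmod z \<le> 8 * cmod (pt k - z)" using True by linarith
    also have "\<dots> \<le> 8 * (real d + 1) * cmod (pt k - z)"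
      by (intro mult_right_mono) auto
    finally show ?thesis .
  next
    case False
    moreover have "8 * (real d + 1) * e = 4" by (simp add: e_def field_simps)
    ultimately have "1 + cmod z \<le> 8 * (real d + 1) * e" by simp
    also have "\<dots> \<le> 8 * (real d + 1) * cmod (pt k - z)"
      using k(2)[OF that] by (intro mult_left_mono) auto
    finally show ?thesis .
  qed
  have "(\<Prod>z\<in>Z. 1 + cmod z) \<le> (\<Prod>z\<in>Z. 8 * (real d + 1) * cmod (pt k - z))"
    using fac by (intro prod_mono) (auto simp: add_nonneg_nonneg)
  also have "\<dots> = (8 * (real d + 1)) ^ d * (\<Prod>z\<in>Z. cmod (pt k - z))"
    using Z by (simp add: prod.distrib)
  finally have "cmod \<kappa> * (\<Prod>z\<in>Z. 1 + cmod z) \<le> cmod \<kappa> * ((8 * (real d + 1)) ^ d * (\<Prod>z\<in>Z. cmod (pt k - z)))"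
    by (rule mult_left_mono) simp
  also have "\<dots> = (8 * (real d + 1)) ^ d * cmod (\<kappa> * (\<Prod>z\<in>Z. pt k - z))"
    by (simp add: norm_mult prod_norm)
  also have "\<dots> \<le> (8 * (real d + 1)) ^ d * B"
    using B[OF pt1] by (intro mult_left_mono) auto
  finally show ?thesis .
qed

text \<open>With [P : Q] = f [x : y], homogenising p - w q = \<kappa> \<Prod>(u - z) gives P - w Q =
  \<kappa> \<Prod>(x - z y). Both sides of the inequality thus have the numerator |P - w Q|. The
  denominators are compared by \<open>leading_coeff_prod_roots_bound\<close>, which bounds
  |\<kappa>| \<Prod>(1 + |z|) by K (1 + |w|), and by \<open>hom_eval_lower_bound\<close>, which
  bounds |P| + |Q| from below.\<close>

lemma prod_chord_fibre_ge:
  assumes rep: "rat_rep p q f" and d: "d = max (degree p) (degree q)"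
  shows "\<exists>c>0. \<forall>w a. card {z. f (Some z) = Some w} = d \<longrightarrow>
    c * chord (Some w) (f a) \<le> (\<Prod>z | f (Some z) = Some w. chord (Some z) a)"
proof -
  note F = rat_repD[OF rep d]
  obtain c0 where c0: "0 < c0"
    "\<And>x y. c0 * (cmod x + cmod y) ^ d \<le> cmod (hom_eval p d x y) + cmod (hom_eval q d x y)"
    using hom_eval_lower_bound[OF rep d] by blast
  have "bounded (poly p ` cball 0 1)" "bounded (poly q ` cball 0 1)"
    by (intro compact_imp_bounded compact_continuous_image continuous_intros compact_cball)+
  then obtain Bp Bq where Bp: "\<And>x. cmod x \<le> 1 \<Longrightarrow> cmod (poly p x) \<le> Bp"
    and Bq: "\<And>x. cmod x \<le> 1 \<Longrightarrow> cmod (poly q x) \<le> Bq"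
    unfolding bounded_iff by (metis imageI mem_cball_0)
  define B where "B = max 1 (max Bp Bq)"
  define K where "K = (8 * (real d + 1)) ^ d * B"
  have K: "0 < K" by (simp add: K_def B_def)
  show ?thesis
  proof (rule exI[of _ "c0 / K"], intro conjI allI impI)
    show "0 < c0 / K" using c0(1) K by simp
    fix w a assume c: "card {z. f (Some z) = Some w} = d"
    obtain x y where xy: "x \<noteq> 0 \<or> y \<noteq> 0" "a = p1_of x y" using ex_p1_of by blast
    define R where "R = p - smult w q"
    define Z where "Z = {z. poly R z = 0}"
    define \<kappa> where "\<kappa> = lead_coeff R"
    have ZF: "{z. f (Some z) = Some w} = Z"
      unfolding Z_def R_def by (rule finite_fibre_eq_roots[OF rep])
    have cZ: "card Z = d" "finite Z" using c F(1) ZF by (auto intro: card_ge_0_finite)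
    have R0: "R \<noteq> 0"
      using cZ(2) infinite_UNIV_char_0[where 'a=complex] by (auto simp: Z_def)
    have "degree R \<le> d" unfolding R_def using F(2,3)
      by (meson degree_diff_le degree_smult_le le_trans)
    then have dR: "degree R = d"
      using card_poly_roots_bound[OF R0] cZ by (simp add: Z_def)
    then have "rsquarefree R" using cZ card_roots_rsquarefree[OF R0] by (simp add: Z_def)
    then have "smult \<kappa> (\<Prod>z\<in>Z. [:-z, 1:]) = R"
      unfolding Z_def \<kappa>_def by (rule complex_poly_decompose_rsquarefree)
    then have Rx: "poly R u = \<kappa> * (\<Prod>z\<in>Z. u - z)" for u
      by (metis (no_types, lifting) poly_smult poly_prod poly_pCons poly_0 mult_zero_right add.right_neutral mult.right_neutral prod.cong uminus_add_conv_diff)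
    have homR: "hom_eval R d x y = \<kappa> * (\<Prod>z\<in>Z. x - z * y)"
    proof (cases "y = 0")
      case True
      then show ?thesis using dR cZ by (simp add: \<kappa>_def)
    next
      case False
      have "hom_eval R d x y = y ^ d * (\<kappa> * (\<Prod>z\<in>Z. x / y - z))"
        using hom_eval_poly[of R d y x] dR False by (simp add: Rx)
      also have "\<dots> = \<kappa> * (\<Prod>z\<in>Z. y * (x / y - z))"
        using cZ by (simp add: prod.distrib)
      also have "(\<lambda>z. y * (x / y - z)) = (\<lambda>z. x - z * y)"
        using False by (auto simp: field_simps)
      finally show ?thesis .
    qed
    have homR': "hom_eval R d x y = hom_eval p d x y - w * hom_eval q d x y"
      by (simp add: hom_eval_def R_def left_diff_distrib sum_subtractf sum_distrib_left mult.assoc)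
    have "cmod (\<kappa> * (\<Prod>z\<in>Z. u - z)) \<le> B * (1 + cmod w)" if "cmod u \<le> 1" for u
    proof -
      have "cmod (poly p u) \<le> B" "cmod (poly q u) \<le> B" using Bp[OF that] Bq[OF that] by (auto simp: B_def)
      then have "cmod (poly p u) + cmod w * cmod (poly q u) \<le> B + cmod w * B"
        by (intro add_mono mult_left_mono) auto
      then have "cmod (poly R u) \<le> B * (1 + cmod w)"
        using norm_triangle_ineq4[of "poly p u" "w * poly q u"] by (simp add: R_def norm_mult algebra_simps)
      then show ?thesis by (simp add: Rx)
    qed
    from leading_coeff_prod_roots_bound[OF cZ(2,1) this]
    have M: "cmod \<kappa> * (\<Prod>z\<in>Z. 1 + cmod z) \<le> K * (1 + cmod w)" by (simp add: K_def mult.assoc)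
    define P Q T where "P = hom_eval p d x y" and "Q = hom_eval q d x y" and "T = cmod (P - w * Q)"
    have PQ: "P \<noteq> 0 \<or> Q \<noteq> 0" unfolding P_def Q_def by (rule hom_eval_nonzero[OF rep d xy(1)])
    have xypos: "0 < cmod x + cmod y" using xy(1) by (smt (verit) norm_ge_zero zero_less_norm_iff)
    have PQpos: "0 < cmod P + cmod Q" using PQ by (smt (verit) norm_ge_zero zero_less_norm_iff)
    have "\<kappa> \<noteq> 0" using R0 by (simp add: \<kappa>_def)
    have prodpos: "0 < (\<Prod>z\<in>Z. 1 + cmod z)" by (rule prod_pos) simp
    have "(\<Prod>z\<in>Z. chord (Some z) a) = (\<Prod>z\<in>Z. cmod (x - z * y)) / ((\<Prod>z\<in>Z. 1 + cmod z) * (cmod x + cmod y) ^ d)"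
      using cZ by (simp add: xy(2) chord_p1_of[OF xy(1)] prod_dividef prod.distrib)
    also have "(\<Prod>z\<in>Z. cmod (x - z * y)) = T / cmod \<kappa>"
      using homR homR' \<open>\<kappa> \<noteq> 0\<close> by (simp add: T_def P_def Q_def norm_mult prod_norm)
    finally have L: "(\<Prod>z\<in>Z. chord (Some z) a) =
        T / ((cmod \<kappa> * (\<Prod>z\<in>Z. 1 + cmod z)) * (cmod x + cmod y) ^ d)"
      by simp
    have "f a = p1_of P Q" unfolding xy(2) P_def Q_def by (rule rat_rep_p1_of[OF rep d xy(1)])
    then have "chord (Some w) (f a) = T / ((1 + cmod w) * (cmod P + cmod Q))"
      using chord_p1_of[OF PQ] by (simp add: T_def)
    then have "c0 / K * chord (Some w) (f a) = T * c0 / (K * (1 + cmod w) * (cmod P + cmod Q))"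
      by (simp add: mult_ac)
    also have "\<dots> \<le> T * c0 / (K * (1 + cmod w) * (c0 * (cmod x + cmod y) ^ d))"
      using c0 K xypos PQpos unfolding P_def Q_def T_def
      by (intro divide_left_mono mult_left_mono mult_pos_pos mult_nonneg_nonneg) auto
    also have "\<dots> = T / (K * (1 + cmod w) * (cmod x + cmod y) ^ d)"
      using c0 by simp
    also have "\<dots> \<le> T / ((cmod \<kappa> * (\<Prod>z\<in>Z. 1 + cmod z)) * (cmod x + cmod y) ^ d)"
      using M xypos K prodpos \<open>\<kappa> \<noteq> 0\<close> unfolding T_def
      by (intro divide_left_mono mult_right_mono mult_pos_pos) auto
    finally show "c0 / K * chord (Some w) (f a) \<le> (\<Prod>z | f (Some z) = Some w. chord (Some z) a)"
      unfolding ZF L .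
  qed
qed

section \<open>Logarithmic distances summed over backward orbits\<close>

context rational_generators
begin

text \<open>Minus the logarithm of \<open>prod_chord_fibre_ge\<close>, with one constant for all
  generators. As \<open>g j a\<close> differs from \<open>y\<close>, every chordal distance involved
  is positive.\<close>

lemma sum_neg_ln_chord_fibre:
  "\<exists>C\<ge>0. \<forall>j<N. \<forall>y a. y \<notin> exc_vals j \<longrightarrow> g j a \<noteq> Some y \<longrightarrow>
     (\<Sum>z | g j (Some z) = Some y. - ln (chord (Some z) a)) \<le> C - ln (chord (Some y) (g j a))"
proof -
  have "\<exists>c>0. \<forall>w a. w \<notin> exc_vals j \<longrightarrow>
    c * chord (Some w) (g j a) \<le> (\<Prod>z | g j (Some z) = Some w. chord (Some z) a)" if "j < N" for j
    using prod_chord_fibre_ge[OF rat_rep_pq[OF nonconst[OF that]] rat_deg_eq[OF rat_rep_pq[OF nonconst[OF that]]]]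
    by (auto simp: exc_vals_def)
  then obtain c where c: "\<And>j. j < N \<Longrightarrow> 0 < c j"
    "\<And>j w a. j < N \<Longrightarrow> w \<notin> exc_vals j \<Longrightarrow>
      c j * chord (Some w) (g j a) \<le> (\<Prod>z | g j (Some z) = Some w. chord (Some z) a)"
    by metis
  define C where "C = (\<Sum>j<N. \<bar>ln (c j)\<bar>)"
  have "(\<Sum>z | g j (Some z) = Some y. - ln (chord (Some z) a)) \<le> C - ln (chord (Some y) (g j a))"
    if j: "j < N" and y: "y \<notin> exc_vals j" and ne: "g j a \<noteq> Some y" for j y a
  proof -
    let ?F = "{z. g j (Some z) = Some y}"
    have pos: "0 < chord (Some z) a" if "z \<in> ?F" for z
      using that ne by (intro chord_pos) auto
    have pos': "0 < chord (Some y) (g j a)" using ne by (intro chord_pos) auto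
    have "ln (c j) + ln (chord (Some y) (g j a)) = ln (c j * chord (Some y) (g j a))"
      using c(1)[OF j] pos' by (simp add: ln_mult)
    also have "\<dots> \<le> ln (\<Prod>z\<in>?F. chord (Some z) a)"
      using c[OF j] y pos' pos by (intro ln_mono) (auto intro!: prod_pos mult_pos_pos)
    also have "\<dots> = (\<Sum>z\<in>?F. ln (chord (Some z) a))"
      using pos finite_fibre(1)[OF j y] by (intro ln_prod) (auto simp: less_imp_neq[symmetric])
    finally have "(\<Sum>z\<in>?F. - ln (chord (Some z) a)) \<le> - ln (c j) - ln (chord (Some y) (g j a))"
      by (simp add: sum_negf)
    moreover have "\<bar>ln (c j)\<bar> \<le> C" unfolding C_def by (rule member_le_sum) (use j in auto)
    ultimately show ?thesis by linarith
  qed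
  moreover have "0 \<le> C" by (simp add: C_def sum_nonneg)
  ultimately show ?thesis by blast
qed

text \<open>Induction on the length: summing over the fibres of the first letter \<open>j\<close>
  moves the target from \<open>a\<close> to \<open>g j a\<close> and costs \<open>C\<close> for each
  preimage under the rest of the word.\<close>

lemma sum_neg_ln_chord_words:
  "\<exists>C. \<forall>w n a. generic w \<longrightarrow> (\<forall>xs. set xs \<subseteq> {..<N} \<longrightarrow> word g xs a \<noteq> Some w) \<longrightarrow>
    (\<Sum>xs\<in>words N n. \<Sum>z\<in>fib xs w. - ln (chord (Some z) a))
      \<le> (\<Sum>xs\<in>words N n. - ln (chord (Some w) (word g xs a))) + C * D ^ n"
proof -
  obtain C where C: "0 \<le> C" "\<And>j y a. j < N \<Longrightarrow> y \<notin> exc_vals j \<Longrightarrow> g j a \<noteq> Some y \<Longrightarrow>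
     (\<Sum>z | g j (Some z) = Some y. - ln (chord (Some z) a)) \<le> C - ln (chord (Some y) (g j a))"
    using sum_neg_ln_chord_fibre by blast
  \<comment> \<open>The solution of N (C + K) = K D: each of the \<open>N\<close> letters adds
    \<open>C * D ^ n\<close> to the earlier error \<open>K * D ^ n\<close>, and the total must be
    \<open>K * D ^ Suc n\<close>.\<close>
  define K where "K = N * C / (D - N)"
  have K: "0 \<le> K" "N * (C + K) = K * D"
    using N_less_D C(1) by (simp_all add: K_def field_simps)
  have "(\<Sum>xs\<in>words N n. \<Sum>z\<in>fib xs w. - ln (chord (Some z) a))
      \<le> (\<Sum>xs\<in>words N n. - ln (chord (Some w) (word g xs a))) + K * D ^ n"
    if w: "generic w" and a: "\<And>xs. set xs \<subseteq> {..<N} \<Longrightarrow> word g xs a \<noteq> Some w" for w n a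
    using a
  proof (induction n arbitrary: a)
    case 0
    then show ?case using K by simp
  next
    case (Suc n)
    have step: "(\<Sum>js\<in>words N n. \<Sum>z\<in>fib (j # js) w. - ln (chord (Some z) a))
      \<le> C * D ^ n + ((\<Sum>js\<in>words N n. - ln (chord (Some w) (word g js (g j a)))) + K * D ^ n)"
      if j: "j < N" for j
    proof -
      have "(\<Sum>js\<in>words N n. \<Sum>z\<in>fib (j # js) w. - ln (chord (Some z) a))
        \<le> (\<Sum>js\<in>words N n. \<Sum>y\<in>fib js w. C - ln (chord (Some y) (g j a)))"
      proof (rule sum_mono)
        fix js assume "js \<in> words N n"
        then have js: "set js \<subseteq> {..<N}" by (simp add: words_def)
        have "g j a \<noteq> Some y" if "y \<in> fib js w" for y
          using Suc.prems[of "j # js"] js j that by (auto simp: fib_def)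
        then show "(\<Sum>z\<in>fib (j # js) w. - ln (chord (Some z) a)) \<le> (\<Sum>y\<in>fib js w. C - ln (chord (Some y) (g j a)))"
          unfolding sum_fib_Cons[OF w js j]
          by (intro sum_mono C(2)[OF j]) (use genericD[OF w js j] in auto)
      qed
      also have "\<dots> = C * (\<Sum>js\<in>words N n. real (card (fib js w))) + (\<Sum>js\<in>words N n. \<Sum>y\<in>fib js w. - ln (chord (Some y) (g j a)))"
        by (simp add: sum.distrib sum_distrib_left sum_subtractf sum_negf mult.commute)
      also have "\<dots> \<le> C * D ^ n + ((\<Sum>js\<in>words N n. - ln (chord (Some w) (word g js (g j a)))) + K * D ^ n)"
      proof -
        have "word g xs (g j a) \<noteq> Some w" if "set xs \<subseteq> {..<N}" for xs
          using Suc.prems[of "j # xs"] that j by simp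
        from Suc.IH[OF this] show ?thesis unfolding sum_card_fib[OF w] by linarith
      qed
      finally show ?thesis .
    qed
    have "(\<Sum>xs\<in>words N (Suc n). \<Sum>z\<in>fib xs w. - ln (chord (Some z) a))
      \<le> (\<Sum>j<N. C * D ^ n + ((\<Sum>js\<in>words N n. - ln (chord (Some w) (word g js (g j a)))) + K * D ^ n))"
      unfolding sum_words_Suc by (rule sum_mono) (use step in auto)
    also have "\<dots> = (\<Sum>xs\<in>words N (Suc n). - ln (chord (Some w) (word g xs a))) + N * (C + K) * D ^ n"
      by (simp add: sum_words_Suc sum.distrib algebra_simps)
    finally show ?case by (simp add: K(2) mult.assoc)
  qed
  then show ?thesis by blast
qed

end

section \<open>The equilibrium measure has no atoms\<close>

lemma sets_p1_borel: "sets p1_borel = {A. Some -` A \<in> sets borel}"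
proof -
  have "sigma_algebra UNIV {A :: p1 set. Some -` A \<in> sets borel}"
    by (auto simp: sigma_algebra_iff2 vimage_UN vimage_Compl Compl_eq_Diff_UNIV[symmetric])
  then show ?thesis
    unfolding p1_borel_def by (simp add: sigma_algebra.sigma_sets_eq)
qed

lemma p1_continuous_bounded:
  assumes "p1_continuous \<phi>"
  shows "\<exists>M\<ge>0. \<forall>x. \<bar>\<phi> x\<bar> \<le> M"
proof -
  have c: "continuous_on UNIV (\<lambda>z. \<phi> (Some z))" "((\<lambda>z. \<phi> (Some z)) \<longlongrightarrow> \<phi> None) at_infinity"
    using assms by (auto simp: p1_continuous_def)
  from tendstoD[OF c(2), of 1] obtain b where b: "\<And>z. b \<le> norm z \<Longrightarrow> dist (\<phi> (Some z)) (\<phi> None) < 1"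
    unfolding eventually_at_infinity by auto
  have "bounded ((\<lambda>z. \<phi> (Some z)) ` cball 0 b)"
    by (intro compact_imp_bounded compact_continuous_image continuous_on_subset[OF c(1)]) auto
  then obtain B where B: "\<And>z. norm z \<le> b \<Longrightarrow> \<bar>\<phi> (Some z)\<bar> \<le> B"
    unfolding bounded_iff by (metis imageI mem_cball_0 real_norm_def)
  have "\<bar>\<phi> x\<bar> \<le> \<bar>B\<bar> + \<bar>\<phi> None\<bar> + 1" for x
  proof (cases x)
    case (Some z)
    then show ?thesis using b[of z] B[of z] by (cases "b \<le> norm z") (auto simp: dist_real_def)
  qed simp
  then show ?thesis by (intro exI[of _ "\<bar>B\<bar> + \<bar>\<phi> None\<bar> + 1"]) auto
qed

locale equilibrium = rational_generators +
  fixes \<mu> :: "p1 measure"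
  assumes equilibrium: "is_equilibrium_measure g N \<mu>"
begin

lemma sets_mu: "sets \<mu> = {A. Some -` A \<in> sets borel}"
  using equilibrium sets_p1_borel by (simp add: is_equilibrium_measure_def)

lemma space_mu [simp]: "space \<mu> = UNIV"
proof -
  have "UNIV \<in> sets \<mu>" by (simp add: sets_mu)
  then show ?thesis using sets.sets_into_space by blast
qed

lemma emeasure_UNIV: "emeasure \<mu> UNIV = 1"
  using equilibrium unfolding is_equilibrium_measure_def space_mu by blast

sublocale finite_measure \<mu>
  by (rule finite_measureI) (simp add: emeasure_UNIV)

lemma measure_UNIV: "measure \<mu> UNIV = 1"
  by (simp add: measure_def emeasure_UNIV)

lemma measurable_muI: "(\<lambda>z. \<phi> (Some z)) \<in> borel_measurable borel \<Longrightarrow> \<phi> \<in> measurable \<mu> borel"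
  by (rule measurableI) (auto simp: sets_mu vimage_def measurable_def)

lemma integrable_p1_continuous:
  assumes "p1_continuous \<phi>"
  shows "integrable \<mu> (\<phi> :: p1 \<Rightarrow> real)"
proof -
  obtain M where "\<And>x. \<bar>\<phi> x\<bar> \<le> M" using p1_continuous_bounded[OF assms] by blast
  moreover have "\<phi> \<in> borel_measurable \<mu>"
    using assms by (intro measurable_muI borel_measurable_continuous_onI) (simp add: p1_continuous_def)
  ultimately show ?thesis by (intro integrable_const_bound[of _ M]) auto
qed

text \<open>Combines \<open>polar_avoid\<close> for the exceptional set of the equilibrium measure
  with a property that holds on almost every circle about each centre.\<close>

lemma ex_generic_point:
  assumes "\<And>z0. AE s in lborel. \<forall>w. dist z0 w = s \<longrightarrow> P w"
  obtains w where "P w" "generic w"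
    "\<And>\<phi>. p1_continuous \<phi> \<Longrightarrow> (\<lambda>n. pullback_pair g N n (Some w) \<phi> / D ^ n) \<longlonglongrightarrow> integral\<^sup>L \<mu> \<phi>"
proof -
  obtain E where E: "polar_P1 E" "\<And>w \<phi>. w \<notin> E \<Longrightarrow> p1_continuous \<phi> \<Longrightarrow>
      (\<lambda>n. pullback_pair g N n w \<phi> / D ^ n) \<longlonglongrightarrow> integral\<^sup>L \<mu> \<phi>"
    using equilibrium by (auto simp: is_equilibrium_measure_def)
  have "\<exists>w. w \<notin> Some -` E \<and> (P w \<and> generic w)"
  proof (rule polar_avoid)
    show "polar_C (Some -` E)" using E(1) by (simp add: polar_P1_def)
    show "AE s in lborel. \<forall>w. dist z0 w = s \<longrightarrow> P w \<and> generic w" for z0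
      using assms[of z0] AE_radius_countable[OF countable_not_generic, of z0] by eventually_elim auto
  qed
  then obtain w where w: "Some w \<notin> E" "P w" "generic w" by auto
  show ?thesis by (rule that[OF w(2,3) E(2)[OF w(1)]])
qed

text \<open>A distance of at least (2N)^-n from \<open>w\<close> makes each term at most A + n L,
  and N^n (A + n L) is eventually below D^n because N < D.\<close>

lemma neg_ln_chord_words_le:
  assumes far: "\<forall>\<^sub>F n in sequentially. \<forall>xs\<in>words N n. \<forall>v\<in>set_option (word g xs a). (1 / (2 * real N)) ^ n \<le> dist w v"
  shows "\<forall>\<^sub>F n in sequentially. (\<Sum>xs\<in>words N n. - ln (chord (Some w) (word g xs a))) \<le> D ^ n"
proof -
  define m where "m = 1 + cmod w"
  define A where "A = ln (2 * m\<^sup>2)"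
  define L where "L = ln (2 * real N)"
  have m: "1 \<le> m" by (simp add: m_def)
  have N2: "1 \<le> 2 * real N" using N_pos by linarith
  have bound: "- ln (chord (Some w) b) \<le> A + n * L"
    if "\<forall>v\<in>set_option b. (1 / (2 * real N)) ^ n \<le> dist w v" for b n
  proof -
    define r where "r = (1 / (2 * real N)) ^ n"
    have r: "0 < r" "r \<le> 1" using N_pos N2 by (auto simp: r_def power_le_one)
    have "r / (2 * m\<^sup>2) \<le> chord (Some w) b"
    proof (cases b)
      case None
      have "r * m \<le> 2 * m\<^sup>2"
        using r m mult_mono[of r 1 m m] by (simp add: power2_eq_square)
      then show ?thesis using m r by (simp add: None m_def[symmetric] field_simps power2_eq_square)
    next
      case (Some v)
      define t where "t = cmod (w - v)"
      have t: "r \<le> t" using that by (simp add: Some r_def t_def dist_norm)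
      have v: "1 + cmod v \<le> m + t"
        using norm_triangle_ineq2[of v w] by (simp add: m_def t_def norm_minus_commute)
      have "r / (2 * m\<^sup>2) \<le> t / (m * (m + t))"
      proof -
        have "r * t \<le> m * t" using r m t by (intro mult_right_mono) auto
        moreover have "r * m \<le> t * m" using t m by (intro mult_right_mono) auto
        ultimately have "r * (m + t) \<le> 2 * m * t" by (simp add: algebra_simps)
        then have "m * (r * (m + t)) \<le> m * (2 * m * t)" using m by (intro mult_left_mono) auto
        then have "r * (m * (m + t)) \<le> t * (2 * m\<^sup>2)" by (simp add: power2_eq_square mult_ac)
        moreover have "0 < 2 * m\<^sup>2" "0 < m * (m + t)" using m t r by auto
        ultimately show ?thesis by (simp only: pos_divide_le_eq times_divide_eq_left pos_le_divide_eq)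
      qed
      also have "\<dots> \<le> t / (m * (1 + cmod v))"
        using v m t r by (intro divide_left_mono mult_left_mono mult_pos_pos) auto
      finally show ?thesis by (simp add: Some m_def t_def)
    qed
    then have "ln (r / (2 * m\<^sup>2)) \<le> ln (chord (Some w) b)"
      using r m by (intro ln_mono) auto
    moreover have "ln (r / (2 * m\<^sup>2)) = - (n * L) - A"
      using r m N_pos by (simp add: ln_div A_def r_def L_def ln_realpow)
    ultimately show ?thesis by simp
  qed
  have "(\<lambda>n. A * (N / D) ^ n + L * (n * (N / D) ^ n)) \<longlonglongrightarrow> A * 0 + L * 0"
    using N_less_D N_pos
    by (intro tendsto_intros LIMSEQ_power_zero powser_times_n_limit_0) auto
  then have "\<forall>\<^sub>F n in sequentially. A * (N / D) ^ n + L * (n * (N / D) ^ n) < 1"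
    by (rule order_tendstoD) simp
  with far show ?thesis
  proof eventually_elim
    case (elim n)
    have "(\<Sum>xs\<in>words N n. - ln (chord (Some w) (word g xs a))) \<le> (\<Sum>xs\<in>words N n. A + n * L)"
      using elim(1) by (intro sum_mono bound) auto
    also have "\<dots> = (A * (N / D) ^ n + L * (n * (N / D) ^ n)) * D ^ n"
      using D_pos by (simp add: card_words field_simps)
    also have "\<dots> \<le> 1 * D ^ n" using elim(2) D_pos by (intro mult_right_mono) auto
    finally show ?case by simp
  qed
qed

text \<open>The function -log of the distance to \<open>a\<close>, cut off at height
  \<open>M\<close> and divided by \<open>M\<close>, is continuous, nonnegative and equal to 1 at
  \<open>a\<close>. Its averages over the preimages of a suitable \<open>w\<close> are eventually at
  most (1 + C) / M, so this bounds the mass of \<open>a\<close> for every \<open>M\<close>.\<close>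

lemma measure_point: "measure \<mu> {a} = 0"
proof -
  let ?B = "\<lambda>n. \<Union>xs\<in>words N n. set_option (word g xs a)"
  have B: "finite (?B n)" "card (?B n) \<le> N ^ n" for n
  proof -
    show "finite (?B n)" by simp
    have "card (?B n) \<le> (\<Sum>xs\<in>words N n. card (set_option (word g xs a)))"
      by (rule card_UN_le) simp
    also have "\<dots> \<le> (\<Sum>xs\<in>words N n. 1)"
    proof (rule sum_mono)
      show "card (set_option (word g xs a)) \<le> 1" for xs by (cases "word g xs a") auto
    qed
    finally show "card (?B n) \<le> N ^ n" by (simp add: card_words)
  qed
  have cB: "countable (\<Union>xs. set_option (word g xs a))"
    by (intro countable_UN) (auto intro: countable_finite)
  let ?P = "\<lambda>w. (\<forall>\<^sub>F n in sequentially. \<forall>v\<in>?B n. (1 / (2 * real N)) ^ n \<le> dist w v)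
      \<and> w \<notin> (\<Union>xs. set_option (word g xs a))"
  have "AE s in lborel. \<forall>w. dist z0 w = s \<longrightarrow> ?P w" for z0
    using AE_radius_far[of ?B, OF B N_pos, of z0] AE_radius_countable[OF cB, of z0]
    by eventually_elim auto
  then obtain w where w: "?P w" "generic w"
    "\<And>\<phi>. p1_continuous \<phi> \<Longrightarrow> (\<lambda>n. pullback_pair g N n (Some w) \<phi> / D ^ n) \<longlonglongrightarrow> integral\<^sup>L \<mu> \<phi>"
    by (rule ex_generic_point) auto
  have ne: "word g xs a \<noteq> Some w" for xs using w(1) by fastforce
  obtain C where C: "\<And>n. (\<Sum>xs\<in>words N n. \<Sum>z\<in>fib xs w. - ln (chord (Some z) a))
      \<le> (\<Sum>xs\<in>words N n. - ln (chord (Some w) (word g xs a))) + C * D ^ n"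
    using sum_neg_ln_chord_words ne w(2) by blast
  have far: "\<forall>\<^sub>F n in sequentially. (\<Sum>xs\<in>words N n. - ln (chord (Some w) (word g xs a))) \<le> D ^ n"
    by (rule neg_ln_chord_words_le) (rule eventually_mono[OF conjunct1[OF w(1)]], blast)
  have le: "measure \<mu> {a} \<le> (1 + C) / M" if M: "0 < M" for M
  proof -
    \<comment> \<open>At \<open>a\<close> the chordal distance is 0, so the maximum is exp (- M) and
      the value is 1.\<close>
    define \<phi> where "\<phi> x = - ln (max (exp (- M)) (chord x a)) / M" for x
    have max_pos: "0 < max (exp (- M)) (chord x a)" for x by (simp add: less_max_iff_disj)
    have \<phi>: "p1_continuous \<phi>"
      using p1_continuous_chord[of a] max_pos M unfolding p1_continuous_def \<phi>_def
      by (auto intro!: continuous_intros tendsto_intros simp: less_imp_neq[symmetric])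
    have \<phi>0: "0 \<le> \<phi> x" for x
    proof -
      have "max (exp (- M)) (chord x a) \<le> 1" using chord_le_1[of x a] M by simp
      then have "ln (max (exp (- M)) (chord x a)) \<le> ln 1" using max_pos by (intro ln_mono) auto
      then show ?thesis using M by (simp add: \<phi>_def divide_nonpos_pos)
    qed
    have "measure \<mu> {a} = (\<integral>x. indicator {a} x \<partial>\<mu>)" by simp
    also have "\<dots> \<le> (\<integral>x. \<phi> x \<partial>\<mu>)"
    proof (rule integral_mono)
      have "Some -` {a} \<in> sets borel" by (cases a) (auto simp: vimage_def)
      then show "integrable \<mu> (indicator {a} :: p1 \<Rightarrow> real)"
        by (intro integrable_real_indicator) (auto simp: sets_mu emeasure_eq_measure)
      show "integrable \<mu> \<phi>" by (rule integrable_p1_continuous[OF \<phi>])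
      show "indicator {a} x \<le> \<phi> x" for x
        using \<phi>0[of x] M chord_eq_0_iff[of a a] by (auto simp: \<phi>_def indicator_def)
    qed
    also have "\<dots> \<le> (1 + C) / M"
    proof (rule tendsto_upperbound[OF w(3)[OF \<phi>]])
      show "\<forall>\<^sub>F n in sequentially. pullback_pair g N n (Some w) \<phi> / D ^ n \<le> (1 + C) / M"
        using far
      proof eventually_elim
        case (elim n)
        have "pullback_pair g N n (Some w) \<phi> \<le> (\<Sum>xs\<in>words N n. \<Sum>z\<in>fib xs w. - ln (chord (Some z) a) / M)"
          unfolding pullback_pair_generic[OF w(2)]
        proof (intro sum_mono)
          fix xs z assume "z \<in> fib xs w"
          then have "Some z \<noteq> a" using ne by (auto simp: fib_def)
          then have "ln (chord (Some z) a) \<le> ln (max (exp (- M)) (chord (Some z) a))"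
            by (intro ln_mono chord_pos) auto
          then show "\<phi> (Some z) \<le> - ln (chord (Some z) a) / M"
            using M unfolding \<phi>_def by (intro divide_right_mono) auto
        qed
        also have "\<dots> = (\<Sum>xs\<in>words N n. \<Sum>z\<in>fib xs w. - ln (chord (Some z) a)) / M"
          by (simp add: sum_divide_distrib)
        also have "\<dots> \<le> ((1 + C) * D ^ n) / M"
          using C[of n] elim M by (intro divide_right_mono) (auto simp: algebra_simps)
        finally have "pullback_pair g N n (Some w) \<phi> / D ^ n \<le> ((1 + C) * D ^ n) / M / D ^ n"
          using D_pos by (intro divide_right_mono) auto
        also have "\<dots> = (1 + C) / M" using D_pos by simp
        finally show ?case .
      qed
    qed simp
    finally show ?thesis .
  qed
  show ?thesis
  proof (rule ccontr)
    assume "measure \<mu> {a} \<noteq> 0"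
    then have p: "0 < measure \<mu> {a}" by (simp add: zero_less_measure_iff)
    \<comment> \<open>Large enough that the mass of \<open>a\<close> times \<open>M\<close> exceeds
      1 + C.\<close>
    define M where "M = (\<bar>1 + C\<bar> + 1) / measure \<mu> {a}"
    have M: "0 < M" using p by (simp add: M_def add_nonneg_pos)
    have "measure \<mu> {a} * M \<le> 1 + C" using le[OF M] M by (simp add: pos_le_divide_eq)
    then show False using p by (simp add: M_def)
  qed
qed

end

section \<open>Slit planes and coverings\<close>

text \<open>The closed half-line that starts at \<open>v\<close> and points away from
  \<open>c\<close>. For v = c the quotient is 0 and the set is empty.\<close>

definition ray :: "complex \<Rightarrow> complex \<Rightarrow> complex set" where
  "ray c v = {z. Im ((z - c) / (v - c)) = 0 \<and> 1 \<le> Re ((z - c) / (v - c))}"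

definition slit_plane :: "complex \<Rightarrow> complex set \<Rightarrow> complex set" where
  "slit_plane c V = - (\<Union>v\<in>V. ray c v)"

lemma closed_ray: "closed (ray c v)"
  unfolding ray_def divide_inverse
  by (intro closed_Collect_conj closed_Collect_eq closed_Collect_le continuous_intros)

lemma ray_eq: "v \<noteq> c \<Longrightarrow> z \<in> ray c v \<longleftrightarrow> (\<exists>t\<ge>1. z = c + complex_of_real t * (v - c))"
proof
  assume v: "v \<noteq> c" and z: "z \<in> ray c v"
  then have "(z - c) / (v - c) = complex_of_real (Re ((z - c) / (v - c)))"
    by (simp add: ray_def complex_eq_iff del: Re_divide Im_divide)
  then have "z = c + complex_of_real (Re ((z - c) / (v - c))) * (v - c)"
    using v by (metis add.commute diff_add_cancel eq_divide_eq right_minus_eq)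
  then show "\<exists>t\<ge>1. z = c + complex_of_real t * (v - c)" using z unfolding ray_def by blast
next
  assume v: "v \<noteq> c" and "\<exists>t\<ge>1. z = c + complex_of_real t * (v - c)"
  then obtain t where "1 \<le> t" "(z - c) / (v - c) = complex_of_real t" by auto
  then show "z \<in> ray c v" unfolding ray_def by simp
qed

lemma open_slit_plane: "finite V \<Longrightarrow> open (slit_plane c V)"
  unfolding slit_plane_def by (intro open_Compl closed_UN) (auto simp: closed_ray)

text \<open>A point of a ray stays on that ray when it is moved further away from \<open>c\<close>,
  so the complement contains the segment from \<open>c\<close> to each of its points.\<close>

lemma starlike_slit_plane: "starlike (slit_plane c V)"
  unfolding starlike_def
proof (intro bexI ballI subsetI)
  show c: "c \<in> slit_plane c V" by (auto simp: slit_plane_def ray_def)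
  fix x z assume x: "x \<in> slit_plane c V" and "z \<in> closed_segment c x"
  then obtain s where s: "0 \<le> s" "s \<le> 1" "z = c + complex_of_real s * (x - c)"
    by (auto simp: in_segment scaleR_conv_of_real algebra_simps)
  have "x \<in> ray c v" if "z \<in> ray c v" for v
  proof -
    define y where "y = (x - c) / (v - c)"
    have eq: "(z - c) / (v - c) = complex_of_real s * y" by (simp add: s(3) y_def)
    have "Im (complex_of_real s * y) = 0 \<and> 1 \<le> Re (complex_of_real s * y)"
      using that unfolding ray_def mem_Collect_eq eq .
    then have y: "s * Im y = 0" "1 \<le> s * Re y" by simp_all
    have "0 < Re y"
    proof (rule ccontr)
      assume "\<not> 0 < Re y"
      then have "s * Re y \<le> 0" using s(1) by (simp add: mult_nonneg_nonpos)
      then show False using y(2) by linarith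
    qed
    then have "s * Re y \<le> 1 * Re y" using s by (intro mult_right_mono) auto
    then have "Im y = 0" "1 \<le> Re y" using y by auto
    then show ?thesis unfolding ray_def y_def by blast
  qed
  then show "z \<in> slit_plane c V" using x by (auto simp: slit_plane_def)
qed

text \<open>A fibre of full size consists of simple roots of R = p - y q, and at such a root (p/q)'
  = R'/q.\<close>

lemma simple_root_deriv:
  assumes rep: "rat_rep p q f" and d: "d = max (degree p) (degree q)"
    and c: "card {z. f (Some z) = Some y} = d" and x: "f (Some x) = Some y"
  shows "deriv (\<lambda>z. poly p z / poly q z) x \<noteq> 0"
proof -
  note F = rat_repD[OF rep d]
  define R where "R = p - smult y q"
  have roots: "{z. f (Some z) = Some y} = {z. poly R z = 0}"
    unfolding R_def by (rule finite_fibre_eq_roots[OF rep])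
  have "finite {z. poly R z = 0}" using c F(1) roots by (auto intro: card_ge_0_finite)
  then have R0: "R \<noteq> 0" using infinite_UNIV_char_0[where 'a=complex] by auto
  have "degree R \<le> d" unfolding R_def using F(2,3)
    by (meson degree_diff_le degree_smult_le le_trans)
  then have "rsquarefree R"
    using card_roots_rsquarefree[OF R0] card_poly_roots_bound[OF R0] c roots by simp
  then have "poly (pderiv R) x \<noteq> 0" using x roots unfolding rsquarefree_roots by blast
  then have R': "poly (pderiv p) x \<noteq> y * poly (pderiv q) x" by (simp add: R_def pderiv_diff pderiv_smult)
  have q: "poly q x \<noteq> 0" "poly p x = y * poly q x"
    using x F(4)[of x] by (auto simp: p1_of_def split: if_splits)
  have "((\<lambda>z. poly p z / poly q z) has_field_derivative
      (poly (pderiv p) x * poly q x - poly p x * poly (pderiv q) x) / (poly q x * poly q x)) (at x)"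
    using q by (auto intro!: derivative_eq_intros)
  then have "deriv (\<lambda>z. poly p z / poly q z) x =
      (poly (pderiv p) x * poly q x - poly p x * poly (pderiv q) x) / (poly q x * poly q x)"
    by (rule DERIV_imp_deriv)
  also have "\<dots> = (poly (pderiv p) x - y * poly (pderiv q) x) / poly q x"
    using q by (simp add: field_simps)
  finally show ?thesis using q R' by simp
qed

text \<open>Over a point \<open>y\<close> outside \<open>V\<close> there are \<open>d\<close>
  preimages, each with a disc on which the map is injective. On a neighbourhood \<open>T\<close> of
  \<open>y\<close> contained in all the images of these discs, the \<open>d\<close> local inverses
  give the sheets.\<close>

lemma rat_rep_covering_space:
  assumes rep: "rat_rep p q f" and d: "d = max (degree p) (degree q)"
    and V: "V = {y. card {z. f (Some z) = Some y} \<noteq> d}"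
  shows "covering_space {z. poly q z \<noteq> 0 \<and> poly p z / poly q z \<notin> V} (\<lambda>z. poly p z / poly q z) (- V)"
proof -
  note F = rat_repD[OF rep d]
  define r where "r z = poly p z / poly q z" for z
  define Q where "Q = {z. poly q z \<noteq> 0}"
  have fr: "f (Some z) = Some y \<longleftrightarrow> z \<in> Q \<and> r z = y" for z y
    using F(4)[of z] by (auto simp: p1_of_def r_def Q_def)
  have Q: "open Q" unfolding Q_def by (rule open_Collect_neq) (auto intro!: continuous_intros)
  have hol: "r holomorphic_on Q" unfolding r_def Q_def by (auto intro!: holomorphic_intros)
  have contr: "continuous_on Q r" using hol by (rule holomorphic_on_imp_continuous_on)
  have "finite V" unfolding V by (rule finite_exceptional_values[OF rep d])
  then have V': "open (- V)" by (simp add: finite_imp_closed open_Compl)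
  define C where "C = {z. z \<in> Q \<and> r z \<notin> V}"
  have "C = Q \<inter> r -` (- V)" by (auto simp: C_def)
  then have "open C" using continuous_open_preimage[OF contr Q V'] by simp
  have fib: "finite {z\<in>Q. r z = y}" "card {z\<in>Q. r z = y} = d" "\<And>x. x \<in> Q \<Longrightarrow> r x = y \<Longrightarrow> deriv r x \<noteq> 0"
    if "y \<notin> V" for y
  proof -
    have "card {z. f (Some z) = Some y} = d" using that V by simp
    then show "card {z\<in>Q. r z = y} = d" by (simp add: fr)
    then show "finite {z\<in>Q. r z = y}" using F(1) by (intro card_ge_0_finite) simp
    show "deriv r x \<noteq> 0" if "x \<in> Q" "r x = y" for x
      using simple_root_deriv[OF rep d \<open>card {z. f (Some z) = Some y} = d\<close>, of x] that
      unfolding fr r_def by simp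
  qed
  have "covering_space C r (- V)"
    unfolding covering_space_def
  proof (intro conjI ballI)
    show "continuous_on C r" by (rule continuous_on_subset[OF contr]) (auto simp: C_def)
    show "r ` C = - V"
    proof
      show "- V \<subseteq> r ` C"
      proof
        fix y assume "y \<in> - V"
        then have "{z\<in>Q. r z = y} \<noteq> {}" using fib(2)[of y] F(1) by (metis Compl_iff card.empty not_one_le_zero)
        then show "y \<in> r ` C" using \<open>y \<in> - V\<close> by (auto simp: C_def)
      qed
    qed (auto simp: C_def)
    fix y assume "y \<in> - V"
    then have y: "y \<notin> V" by simp
    define X where "X = {z\<in>Q. r z = y}"
    have X: "finite X" "card X = d" using fib(1,2)[OF y] by (simp_all add: X_def)
    have "\<exists>e>0. ball x e \<subseteq> Q \<and> inj_on r (ball x e)" if "x \<in> X" for x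
    proof -
      have "x \<in> Q" "deriv r x \<noteq> 0" using that fib(3)[OF y] by (auto simp: X_def)
      from has_complex_derivative_locally_invertible[OF hol this(1) Q this(2)] show ?thesis by blast
    qed
    then obtain e where e: "\<And>x. x \<in> X \<Longrightarrow> 0 < e x \<and> ball x (e x) \<subseteq> Q \<and> inj_on r (ball x (e x))"
      by metis
    \<comment> \<open>Half the distance to the other points of the fibre makes the discs disjoint;
      the 1 keeps the set nonempty when the fibre is a single point.\<close>
    define e' where "e' x = min (e x) (Min (insert 1 ((\<lambda>x'. dist x x' / 2) ` (X - {x}))))" for x
    have e'pos: "0 < e' x" if "x \<in> X" for x
      using e[OF that] X(1) by (auto simp: e'_def Min_gr_iff)
    have e'le: "e' x \<le> dist x x' / 2" if "x' \<in> X" "x' \<noteq> x" for x x'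
    proof -
      have "Min (insert 1 ((\<lambda>x'. dist x x' / 2) ` (X - {x}))) \<le> dist x x' / 2"
        using that X(1) by (intro Min_le) auto
      then show ?thesis unfolding e'_def by linarith
    qed
    have e': "ball x (e' x) \<subseteq> Q" "inj_on r (ball x (e' x))" if "x \<in> X" for x
    proof -
      have "ball x (e' x) \<subseteq> ball x (e x)" by (auto simp: e'_def)
      then show "ball x (e' x) \<subseteq> Q" "inj_on r (ball x (e' x))"
        using e[OF that] by (auto intro: inj_on_subset)
    qed
    have disj: "ball x (e' x) \<inter> ball x' (e' x') = {}" if "x \<in> X" "x' \<in> X" "x \<noteq> x'" for x x'
    proof -
      have "False" if z: "dist x z < e' x" "dist x' z < e' x'" for z
        using e'le[of x' x] e'le[of x x'] \<open>x \<in> X\<close> \<open>x' \<in> X\<close> \<open>x \<noteq> x'\<close> z dist_triangle2[of x x' z]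
        by (simp add: dist_commute)
      then show ?thesis by auto
    qed
    define T where "T = (- V) \<inter> (\<Inter>x\<in>X. r ` ball x (e' x))"
    have opball: "open (r ` ball x (e' x))" if "x \<in> X" for x
      using open_mapping_thm3[OF holomorphic_on_subset[OF hol e'(1)[OF that]] _ e'(2)[OF that]] by simp
    have "open T" unfolding T_def using V' X(1) opball by (intro open_Int open_INT) auto
    have "y \<in> T" unfolding T_def using y e'pos by (force simp: X_def)
    define u where "u x = ball x (e' x) \<inter> r -` T" for x
    have u_open: "open (u x)" if "x \<in> X" for x
      unfolding u_def
      using continuous_open_preimage[OF continuous_on_subset[OF contr e'(1)[OF that]] _ \<open>open T\<close>] by simp
    have u_im: "r ` u x = T" if "x \<in> X" for x
    proof
      show "T \<subseteq> r ` u x"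
      proof
        fix t assume t: "t \<in> T"
        then obtain s where "s \<in> ball x (e' x)" "t = r s" using \<open>x \<in> X\<close> unfolding T_def by blast
        then show "t \<in> r ` u x" using t unfolding u_def by blast
      qed
    qed (auto simp: u_def)
    \<comment> \<open>Each point of \<open>T\<close> has a preimage in each of the \<open>d\<close>
      disjoint discs. These already exhaust its fibre, so no preimage lies elsewhere.\<close>
    have cover: "(\<Union>x\<in>X. u x) = C \<inter> r -` T"
    proof
      show "(\<Union>x\<in>X. u x) \<subseteq> C \<inter> r -` T"
        using e'(1) by (auto simp: u_def C_def T_def)
      show "C \<inter> r -` T \<subseteq> (\<Union>x\<in>X. u x)"
      proof
        fix z assume z: "z \<in> C \<inter> r -` T"
        then have rz: "r z \<in> T" "r z \<notin> V" "z \<in> Q" by (auto simp: C_def)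
        have "\<exists>s. s \<in> u x \<and> r s = r z" if "x \<in> X" for x using rz(1) u_im[OF that] by (metis imageE)
        then obtain s where s: "\<And>x. x \<in> X \<Longrightarrow> s x \<in> u x \<and> r (s x) = r z" by metis
        have "inj_on s X" using s disj unfolding inj_on_def u_def by (metis IntD1 IntI empty_iff)
        moreover have "s ` X \<subseteq> {z'\<in>Q. r z' = r z}" using s e'(1) unfolding u_def by blast
        ultimately have "s ` X = {z'\<in>Q. r z' = r z}"
          using fib(1,2)[OF rz(2)] X(2) by (intro card_subset_eq) (auto simp: card_image)
        then have "z \<in> s ` X" using rz(3) by blast
        then show "z \<in> (\<Union>x\<in>X. u x)" using s by blast
      qed
    qed
    show "\<exists>T. y \<in> T \<and> openin (top_of_set (- V)) T \<and>
        (\<exists>v. \<Union>v = C \<inter> r -` T \<and> (\<forall>u\<in>v. openin (top_of_set C) u) \<and> pairwise disjnt v \<and>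
             (\<forall>u\<in>v. \<exists>q. homeomorphism u T r q))"
    proof (intro exI[of _ T] conjI exI[of _ "u ` X"] ballI)
      show "y \<in> T" by fact
      show "openin (top_of_set (- V)) T" using \<open>open T\<close> by (intro open_subset) (auto simp: T_def)
      show "\<Union>(u ` X) = C \<inter> r -` T" using cover by simp
      show "openin (top_of_set C) v" if "v \<in> u ` X" for v
        using that cover u_open by (intro open_subset) auto
      show "pairwise disjnt (u ` X)"
        using disj unfolding pairwise_def disjnt_def u_def by blast
      show "\<exists>q. homeomorphism v T r q" if v: "v \<in> u ` X" for v
      proof -
        obtain x where x: "x \<in> X" "v = u x" using v by blast
        have "v \<subseteq> Q" "inj_on r v" using e'[OF x(1)] by (auto simp: x(2) u_def intro: inj_on_subset)
        then obtain k where k: "k holomorphic_on (r ` v)" "\<And>z. z \<in> v \<Longrightarrow> k (r z) = z"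
          using holomorphic_has_inverse[OF holomorphic_on_subset[OF hol], of v] u_open x by metis
        have T: "r ` v = T" using u_im[OF x(1)] x(2) by simp
        have "homeomorphism v T r k"
        proof (rule homeomorphismI)
          show "continuous_on v r" using contr \<open>v \<subseteq> Q\<close> by (rule continuous_on_subset)
          show "continuous_on T k" using holomorphic_on_imp_continuous_on[OF k(1)] by (simp add: T)
          show "r ` v \<subseteq> T" "k ` T \<subseteq> v" using T k(2) by auto
          show "k (r z) = z" if "z \<in> v" for z using that by (rule k(2))
          show "r (k t) = t" if "t \<in> T" for t using that k(2) unfolding T[symmetric] by auto
        qed
        then show ?thesis by blast
      qed
    qed
  qed
  then show ?thesis unfolding C_def r_def Q_def by simp
qed

section \<open>Inverse branches\<close>

text \<open>The values of \<open>h\<close> avoid the exceptional set, so \<open>h\<close> lifts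
  through the covering since \<open>U\<close> is simply connected. The continuous lift is
  holomorphic because it agrees locally with a holomorphic local inverse composed with
  \<open>h\<close>.\<close>

lemma rat_rep_lift:
  assumes rep: "rat_rep p q f" and d: "d = max (degree p) (degree q)"
    and U: "open U" "simply_connected U" "w \<in> U"
    and h: "h holomorphic_on U" "\<And>z. z \<in> U \<Longrightarrow> card {x. f (Some x) = Some (h z)} = d"
    and x: "f (Some x) = Some (h w)"
  shows "\<exists>k. k holomorphic_on U \<and> k w = x \<and> (\<forall>z\<in>U. f (Some (k z)) = Some (h z))"
proof -
  note F = rat_repD[OF rep d]
  define V where "V = {y. card {z. f (Some z) = Some y} \<noteq> d}"
  define r where "r z = poly p z / poly q z" for z
  define Q where "Q = {z. poly q z \<noteq> 0}"
  define C where "C = {z. poly q z \<noteq> 0 \<and> r z \<notin> V}"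
  have fr: "f (Some z) = Some y \<longleftrightarrow> z \<in> Q \<and> r z = y" for z y
    using F(4)[of z] by (auto simp: p1_of_def r_def Q_def)
  have Q: "open Q" unfolding Q_def by (rule open_Collect_neq) (auto intro!: continuous_intros)
  have hol: "r holomorphic_on Q" unfolding r_def Q_def by (auto intro!: holomorphic_intros)
  have cov: "covering_space C r (- V)"
    using rat_rep_covering_space[OF rep d V_def] unfolding C_def r_def[abs_def] .
  have hV: "h z \<notin> V" if "z \<in> U" for z using h(2)[OF that] by (simp add: V_def)
  have conth: "continuous_on U h" using h(1) by (rule holomorphic_on_imp_continuous_on)
  have xC: "x \<in> C" "r x = h w" using x hV[OF U(3)] unfolding fr by (auto simp: C_def Q_def)
  obtain k where k: "continuous_on U k" "k \<in> U \<rightarrow> C" "k w = x" "\<And>z. z \<in> U \<Longrightarrow> r (k z) = h z"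
  proof (rule covering_space_lift_strong[OF cov xC(1) U(3,2) open_imp_locally_path_connected[OF U(1)] conth])
    show "h \<in> U \<rightarrow> - V" using hV by auto
    show "h w = r x" using xC by simp
  qed auto
  have kQ: "k z \<in> Q" if "z \<in> U" for z using k(2) that by (auto simp: C_def Q_def)
  have "k holomorphic_on U"
    unfolding holomorphic_on_open[OF U(1)]
  proof
    fix z assume z: "z \<in> U"
    have "f (Some (k z)) = Some (h z)" using k(4)[OF z] kQ[OF z] fr by blast
    then have "deriv r (k z) \<noteq> 0"
      using simple_root_deriv[OF rep d h(2)[OF z]] unfolding r_def by blast
    from has_complex_derivative_locally_invertible[OF hol kQ[OF z] Q this]
    obtain e where e: "0 < e" "ball (k z) e \<subseteq> Q" "open (r ` ball (k z) e)" "inj_on r (ball (k z) e)"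
      by blast
    obtain s where s: "s holomorphic_on (r ` ball (k z) e)" "\<And>y. y \<in> ball (k z) e \<Longrightarrow> s (r y) = y"
      using holomorphic_has_inverse[OF holomorphic_on_subset[OF hol e(2)] open_ball e(4)] by metis
    define W where "W = U \<inter> k -` ball (k z) e"
    have W: "open W" "z \<in> W" unfolding W_def
      using continuous_open_preimage[OF k(1) U(1)] e(1) z by auto
    have "h u \<in> r ` ball (k z) e" if "u \<in> W" for u
    proof -
      have "h u = r (k u)" "k u \<in> ball (k z) e" using k(4) that by (auto simp: W_def)
      then show ?thesis by blast
    qed
    then have "(s \<circ> h) holomorphic_on W"
      using h(1) by (intro holomorphic_on_compose_gen[OF _ s(1)]) (auto simp: W_def intro: holomorphic_on_subset)
    then have "(\<lambda>u. s (h u)) holomorphic_on W" by (simp add: o_def)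
    moreover have "s (h u) = k u" if "u \<in> W" for u
      using s(2)[of "k u"] k(4)[of u] that by (auto simp: W_def)
    ultimately have "k holomorphic_on W" by (rule holomorphic_transform)
    then show "\<exists>f'. (k has_field_derivative f') (at z)"
      using W holomorphic_on_open by blast
  qed
  then show ?thesis using k kQ fr by blast
qed

text \<open>The image of the first branch is open, so the branches agree near a common point.\<close>
lemma inverse_branch_unique:
  fixes f :: "p1 \<Rightarrow> p1"
  assumes U: "open U" "connected U"
    and h: "h holomorphic_on U" "\<And>z. z \<in> U \<Longrightarrow> f (Some (h z)) = Some z"
    and k: "k holomorphic_on U" "\<And>z. z \<in> U \<Longrightarrow> f (Some (k z)) = Some z"
    and z: "z1 \<in> U" "z2 \<in> U" "h z1 = k z2" and u: "u \<in> U"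
  shows "h u = k u"
proof -
  have "z1 = z2" using h(2)[OF z(1)] k(2)[OF z(2)] z(3) by simp
  have inj: "inj_on h U" using h(2) by (metis inj_onI option.inject)
  have "open (h ` U)" by (rule open_mapping_thm3[OF h(1) U(1) inj])
  then have "open (U \<inter> k -` (h ` U))"
    using continuous_open_preimage[OF holomorphic_on_imp_continuous_on[OF k(1)] U(1)] by blast
  moreover have eq: "U \<inter> k -` (h ` U) = {x \<in> U. h x = k x}"
  proof
    show "U \<inter> k -` (h ` U) \<subseteq> {x \<in> U. h x = k x}"
    proof
      fix x assume "x \<in> U \<inter> k -` (h ` U)"
      then obtain y where y: "x \<in> U" "y \<in> U" "k x = h y" by auto
      then have "x = y" using h(2)[OF y(2)] k(2)[OF y(1)] by simp
      then show "x \<in> {x \<in> U. h x = k x}" using y by simp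
    qed
    show "{x \<in> U. h x = k x} \<subseteq> U \<inter> k -` (h ` U)" by (auto simp: image_iff) metis
  qed
  ultimately have op: "openin (top_of_set U) {x \<in> U. h x = k x}"
    by (metis (no_types, lifting) Int_lower1 open_subset)
  have "closedin (top_of_set U) {x \<in> U. h x - k x = 0}"
    using h(1) k(1) by (intro continuous_closedin_preimage_constant continuous_on_diff holomorphic_on_imp_continuous_on)
  then have "closedin (top_of_set U) {x \<in> U. h x = k x}" by simp
  then have "{x \<in> U. h x = k x} = {} \<or> {x \<in> U. h x = k x} = U"
    using op U(2) unfolding connected_clopen by blast
  moreover have "z1 \<in> {x \<in> U. h x = k x}" using z \<open>z1 = z2\<close> by simp
  ultimately show ?thesis using u by blast
qed

text \<open>Near \<open>x\<close> the map \<open>f\<close> is the inverse \<open>k\<close> of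
  \<open>h\<close>, so its multiplier is the reciprocal of \<open>deriv h x\<close>.\<close>

lemma inverse_branch_repelling:
  assumes U: "open U" and h: "h holomorphic_on U" "\<And>z. z \<in> U \<Longrightarrow> f (Some (h z)) = Some z"
    and x: "x \<in> U" "h x = x" "cmod (deriv h x) < 1"
  shows "repelling_fixed f (Some x)"
proof -
  have inj: "inj_on h U" using h(2) by (metis inj_onI option.inject)
  obtain k where k: "k holomorphic_on (h ` U)" "\<And>z. z \<in> U \<Longrightarrow> deriv h z * deriv k (h z) = 1"
    "\<And>z. z \<in> U \<Longrightarrow> k (h z) = z"
    using holomorphic_has_inverse[OF h(1) U inj] by metis
  have hU: "open (h ` U)" by (rule open_mapping_thm3[OF h(1) U inj])
  have xh: "x \<in> h ` U" using x by (metis imageI)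
  have "(k has_field_derivative deriv k x) (at x)"
    using k(1) hU xh by (rule holomorphic_derivI)
  moreover have "k y = (case f (Some y) of Some v \<Rightarrow> v | None \<Rightarrow> 0)" if "y \<in> h ` U" for y
    using that k(3) h(2) by auto
  ultimately have "((\<lambda>z. case f (Some z) of Some v \<Rightarrow> v | None \<Rightarrow> 0) has_field_derivative deriv k x) (at x)"
    by (rule has_field_derivative_transform_within_open[OF _ hU xh])
  moreover have prod: "cmod (deriv h x) * cmod (deriv k x) = 1"
    using k(2)[OF x(1)] x(2) by (metis norm_mult norm_one)
  have "1 < cmod (deriv k x)"
  proof (rule ccontr)
    assume "\<not> ?thesis"
    then have "cmod (deriv h x) * cmod (deriv k x) \<le> cmod (deriv h x) * 1"
      by (intro mult_left_mono) auto
    then show False using x(3) prod by simp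
  qed
  ultimately show ?thesis
    using h(2)[OF x(1)] x(2) unfolding repelling_fixed_def by auto
qed

text \<open>Brouwer's theorem gives a fixed point \<open>x\<close> in the disc of radius e/4. The
  disc of radius e/2 about \<open>x\<close> still lies in the large one, and Cauchy's estimate there
  bounds the derivative by (e/4) / (e/2) = 1/2.\<close>

lemma contracting_fixed_point:
  assumes h: "h holomorphic_on U" and e: "0 < e" "cball b e \<subseteq> U"
    and c: "\<And>z. z \<in> cball b e \<Longrightarrow> dist (h z) b \<le> e / 4"
  shows "\<exists>x\<in>cball b (e / 4). h x = x \<and> cmod (deriv h x) < 1"
proof -
  have cont: "continuous_on (cball b e) h"
    using h e(2) by (meson holomorphic_on_imp_continuous_on holomorphic_on_subset)
  obtain x where x: "x \<in> cball b (e / 4)" "h x = x"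
  proof (rule brouwer_ball[of "e / 4" b h])
    show "continuous_on (cball b (e / 4)) h"
      by (rule continuous_on_subset[OF cont]) (use e in auto)
    show "h \<in> cball b (e / 4) \<rightarrow> cball b (e / 4)"
      using c e(1) by (auto simp: dist_commute)
  qed (use e in auto)
  have sub: "cball x (e / 2) \<subseteq> cball b e"
  proof
    fix z assume "z \<in> cball x (e / 2)"
    then show "z \<in> cball b e" using x(1) e(1) dist_triangle[of b z x] by simp
  qed
  have "cmod ((deriv ^^ 1) (\<lambda>z. h z - b) x) \<le> fact 1 * (e / 4) / (e / 2) ^ 1"
  proof (rule Cauchy_inequality)
    show "(\<lambda>z. h z - b) holomorphic_on ball x (e / 2)"
      using holomorphic_on_subset[OF h, of "ball x (e / 2)"] sub e(2) ball_subset_cball[of x "e / 2"]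
      by (intro holomorphic_intros) blast
    show "continuous_on (cball x (e / 2)) (\<lambda>z. h z - b)"
      using continuous_on_subset[OF cont sub] by (intro continuous_intros)
    show "cmod (h z - b) \<le> e / 4" if "cmod (x - z) = e / 2" for z
      using c[of z] sub that by (auto simp: dist_norm subset_iff)
  qed (use e in auto)
  moreover have "deriv (\<lambda>z. h z - b) x = deriv h x"
  proof -
    have "h holomorphic_on ball b e" using h e(2) by (meson ball_subset_cball holomorphic_on_subset)
    then have "h field_differentiable at x"
      using x(1) e(1) by (intro holomorphic_on_imp_differentiable_at[of h "ball b e"]) auto
    then show ?thesis by simp
  qed
  ultimately show ?thesis using x e(1) by auto
qed

text \<open>Rescaling by a grid of mesh \<open>\<eta>\<close>, a function omitting the grid becomes one omitting 0 and 1
  with controlled value at the base point, so Schottky's theorem bounds its oscillation by a multiple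
  of \<open>\<eta>\<close>.\<close>
lemma small_oscillation:
  assumes U: "open U" "connected U" "w \<in> U" and K: "compact K" "K \<subseteq> U" and K1: "compact K1" and \<delta>: "0 < \<delta>"
  shows "\<exists>G. finite G \<and> (\<forall>h z. h holomorphic_on U \<longrightarrow> h w \<in> K1 \<longrightarrow> h ` U \<inter> G = {} \<longrightarrow> z \<in> K \<longrightarrow>
    dist (h z) (h w) \<le> \<delta>)"
proof -
  define X where "X = {f. f holomorphic_on U \<and> (\<forall>z\<in>U. f z \<noteq> 0 \<and> f z \<noteq> 1)}"
  define Y where "Y = {f \<in> X. cmod (f w) \<le> 1}"
  obtain B where B: "\<And>f z. f \<in> Y \<Longrightarrow> z \<in> K \<Longrightarrow> cmod (f z) \<le> B"
    by (rule GPicard3[OF U, of Y X K]) (use K in \<open>auto simp: X_def Y_def\<close>)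
  \<comment> \<open>Chosen so that the final bound |B| \<eta> + \<eta> equals \<delta>;
    \<open>B\<close> is uniform over all functions omitting 0 and 1 whose value at \<open>w\<close>
    has modulus at most 1.\<close>
  define \<eta> where "\<eta> = \<delta> / (\<bar>B\<bar> + 1)"
  have \<eta>: "0 < \<eta>" "(\<bar>B\<bar> + 1) * \<eta> = \<delta>" using \<delta> by (auto simp: \<eta>_def)
  obtain k where k: "finite k" "K1 \<subseteq> (\<Union>x\<in>k. ball x \<eta>)"
    using K1 \<eta>(1) unfolding compact_eq_totally_bounded by blast
  \<comment> \<open>The map u \<mapsto> (u - x) / \<eta> sends the grid point \<open>x\<close> to 0
    and its translate to 1.\<close>
  define G where "G = k \<union> (\<lambda>x. x + of_real \<eta>) ` k"
  have "dist (h z) (h w) \<le> \<delta>"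
    if h: "h holomorphic_on U" "h w \<in> K1" "h ` U \<inter> G = {}" and z: "z \<in> K" for h z
  proof -
    obtain x where x: "x \<in> k" "dist x (h w) < \<eta>" using h(2) k(2) by auto
    define f where "f u = (h u - x) / of_real \<eta>" for u
    have "f holomorphic_on U" unfolding f_def using h(1) \<eta> by (intro holomorphic_intros) auto
    moreover have "f u \<noteq> 0 \<and> f u \<noteq> 1" if "u \<in> U" for u
    proof -
      have "x \<in> G" "x + of_real \<eta> \<in> G" using x(1) by (auto simp: G_def)
      moreover have "h u \<notin> G" using h(3) that by auto
      ultimately have "h u \<noteq> x" "h u \<noteq> x + of_real \<eta>" by metis+
      then show ?thesis using \<eta>(1) by (auto simp: f_def field_simps)
    qed
    moreover have "cmod (f w) \<le> 1"
      using x(2) \<eta>(1) by (simp add: f_def norm_divide dist_norm norm_minus_commute)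
    ultimately have "f \<in> Y" by (auto simp: X_def Y_def)
    from B[OF this z] have "cmod (f z) \<le> \<bar>B\<bar>" by linarith
    then have "dist (h z) x \<le> \<bar>B\<bar> * \<eta>"
      using \<eta>(1) by (simp add: f_def norm_divide dist_norm divide_le_eq)
    then have "dist (h z) (h w) \<le> \<bar>B\<bar> * \<eta> + \<eta>"
      using x(2) dist_triangle[of "h z" "h w" x] by simp
    then show ?thesis using \<eta>(2) by (simp add: algebra_simps)
  qed
  moreover have "finite G" using k(1) by (simp add: G_def)
  ultimately show ?thesis by blast
qed

section \<open>Counting inverse branches\<close>

context rational_generators
begin

definition branch :: "complex set \<Rightarrow> nat list \<Rightarrow> (complex \<Rightarrow> complex) \<Rightarrow> bool" where
  "branch U xs h \<longleftrightarrow> h holomorphic_on U \<and> (\<forall>z\<in>U. word g xs (Some (h z)) = Some z)"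

text \<open>Branches are recorded by their values at \<open>w\<close>, which determine them on a
  connected open \<open>U\<close> by \<open>branch_unique\<close>.\<close>

definition good :: "complex set \<Rightarrow> nat list \<Rightarrow> complex \<Rightarrow> complex set" where
  "good U xs w = {h w |h. branch U xs h}"

definition hits :: "complex set \<Rightarrow> complex set \<Rightarrow> nat list \<Rightarrow> complex \<Rightarrow> complex set" where
  "hits A U xs w = {h w |h. branch U xs h \<and> h ` U \<inter> A \<noteq> {}}"

lemma good_subset_fib: "w \<in> U \<Longrightarrow> good U xs w \<subseteq> fib xs w"
  by (auto simp: good_def branch_def fib_def)

lemma branch_unique:
  assumes "open U" "connected U" "branch U xs h" "branch U xs k" "z1 \<in> U" "z2 \<in> U" "h z1 = k z2" "u \<in> U"
  shows "h u = k u"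
  using inverse_branch_unique[of U h "word g xs" k z1 z2 u] assms by (simp add: branch_def)

text \<open>Distinct branches of one word have disjoint images, so each point of \<open>A\<close> is
  met by at most one of them. The bound does not depend on the word.\<close>

lemma hits_card:
  assumes U: "open U" "connected U" "w \<in> U" and A: "finite A"
  shows "finite (hits A U xs w) \<and> card (hits A U xs w) \<le> card A"
proof -
  have "\<forall>x\<in>hits A U xs w. \<exists>a h z. a \<in> A \<and> branch U xs h \<and> h w = x \<and> z \<in> U \<and> h z = a"
    unfolding hits_def by blast
  then obtain a h z where ahz: "\<And>x. x \<in> hits A U xs w \<Longrightarrow>
      a x \<in> A \<and> branch U xs (h x) \<and> h x w = x \<and> z x \<in> U \<and> h x (z x) = a x"
    by metis
  have "inj_on a (hits A U xs w)"
  proof (rule inj_onI)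
    fix x y assume xy: "x \<in> hits A U xs w" "y \<in> hits A U xs w" "a x = a y"
    then have "h x w = h y w"
      using ahz[OF xy(1)] ahz[OF xy(2)] U by (intro branch_unique[of U xs "h x" "h y" "z x" "z y" w]) auto
    then show "x = y" using ahz[OF xy(1)] ahz[OF xy(2)] by simp
  qed
  moreover have "a ` hits A U xs w \<subseteq> A" using ahz by blast
  ultimately show ?thesis using A by (meson card_inj_on_le inj_on_finite)
qed

text \<open>A branch with value \<open>y\<close> at \<open>w\<close> that avoids the exceptional
  values of \<open>g j\<close> lifts through \<open>g j\<close> to a branch through any chosen
  preimage of \<open>y\<close>.\<close>

lemma good_Cons:
  assumes U: "open U" "simply_connected U" "w \<in> U" and j: "j < N"
    and y: "y \<in> good U js w" "y \<notin> hits (exc_vals j) U js w" and x: "g j (Some x) = Some y"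
  shows "x \<in> good U (j # js) w"
proof -
  obtain h where h: "branch U js h" "h w = y" using y(1) by (auto simp: good_def)
  then have "h ` U \<inter> exc_vals j = {}" using y(2) by (auto simp: hits_def)
  then have "card {x. g j (Some x) = Some (h z)} = rat_deg (g j)" if "z \<in> U" for z
    using that by (auto simp: exc_vals_def)
  then obtain k where "k holomorphic_on U" "k w = x" "\<forall>z\<in>U. g j (Some (k z)) = Some (h z)"
    using rat_rep_lift[OF rat_rep_pq[OF nonconst[OF j]] rat_deg_eq[OF rat_rep_pq[OF nonconst[OF j]]] U, of h x]
      h x by (auto simp: branch_def)
  then have "branch U (j # js) k" "k w = x" using h(1) by (auto simp: branch_def)
  then show ?thesis by (auto simp: good_def)
qed

definition n_bad :: "complex set \<Rightarrow> complex \<Rightarrow> nat \<Rightarrow> nat" where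
  "n_bad U w n = (\<Sum>xs\<in>words N n. card (fib xs w - good U xs w))"

text \<open>Every exceptional value of \<open>g j\<close> spoils at most one branch per word, and
  each spoiled branch costs \<open>rat_deg (g j)\<close> preimages.\<close>

definition n_exc :: nat where
  "n_exc = (\<Sum>j<N. rat_deg (g j) * card (exc_vals j))"

text \<open>A preimage that is not good lies over one that was already not good, or over one whose
  branch meets an exceptional value of the new letter. The latter are counted by
  \<open>hits_card\<close>.\<close>

lemma n_bad_Suc:
  assumes U: "open U" "simply_connected U" "w \<in> U" and w: "generic w"
  shows "n_bad U w (Suc n) \<le> total_deg g N * n_bad U w n + n_exc * N ^ n"
proof -
  have conn: "connected U" using U(2) by (rule simply_connected_imp_connected)
  have step: "card (fib (j # js) w - good U (j # js) w)
      \<le> rat_deg (g j) * card (fib js w - good U js w) + rat_deg (g j) * card (exc_vals j)"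
    if j: "j < N" and "js \<in> words N n" for j js
  proof -
    have js: "set js \<subseteq> {..<N}" using that by (auto simp: words_def)
    let ?H = "hits (exc_vals j) U js w"
    let ?Y = "(fib js w - good U js w) \<union> (?H \<inter> fib js w)"
    have H: "finite ?H" "card ?H \<le> card (exc_vals j)"
      using hits_card[OF U(1) conn U(3) finite_exc_vals[OF j]] by auto
    have fibre: "finite {x. g j (Some x) = Some y}" "card {x. g j (Some x) = Some y} = rat_deg (g j)"
      if "y \<in> fib js w" for y
      using finite_fibre[OF j genericD[OF w js j that]] .
    have Y: "finite ?Y" using finite_fib[OF w js] by simp
    have "fib (j # js) w - good U (j # js) w \<subseteq> (\<Union>y\<in>?Y. {x. g j (Some x) = Some y})"
    proof
      fix x assume x: "x \<in> fib (j # js) w - good U (j # js) w"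
      then obtain y where y: "y \<in> fib js w" "g j (Some x) = Some y" using fib_Cons[OF w js] by auto
      then have "y \<in> ?Y" using good_Cons[OF U j _ _ y(2)] x by blast
      then show "x \<in> (\<Union>y\<in>?Y. {x. g j (Some x) = Some y})" using y(2) by blast
    qed
    then have "card (fib (j # js) w - good U (j # js) w) \<le> card (\<Union>y\<in>?Y. {x. g j (Some x) = Some y})"
      using Y fibre(1) by (intro card_mono) auto
    also have "\<dots> \<le> (\<Sum>y\<in>?Y. card {x. g j (Some x) = Some y})" using Y by (rule card_UN_le)
    also have "\<dots> = (\<Sum>y\<in>?Y. rat_deg (g j))" by (rule sum.cong) (use fibre(2) in auto)
    also have "\<dots> = rat_deg (g j) * card ?Y" by (simp add: mult.commute)
    also have "\<dots> \<le> rat_deg (g j) * (card (fib js w - good U js w) + card (exc_vals j))"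
    proof (rule mult_le_mono2)
      have "card ?Y \<le> card (fib js w - good U js w) + card (?H \<inter> fib js w)" by (rule card_Un_le)
      moreover have "card (?H \<inter> fib js w) \<le> card ?H" using H(1) by (intro card_mono) auto
      ultimately show "card ?Y \<le> card (fib js w - good U js w) + card (exc_vals j)" using H(2) by linarith
    qed
    finally show ?thesis by (simp add: distrib_left)
  qed
  have "n_bad U w (Suc n) \<le> (\<Sum>j<N. \<Sum>js\<in>words N n.
      rat_deg (g j) * card (fib js w - good U js w) + rat_deg (g j) * card (exc_vals j))"
    unfolding n_bad_def sum_words_Suc by (intro sum_mono step) auto
  also have "\<dots> = (\<Sum>j<N. rat_deg (g j) * n_bad U w n + rat_deg (g j) * card (exc_vals j) * N ^ n)"
    by (simp add: sum.distrib n_bad_def sum_distrib_left card_words mult_ac)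
  also have "\<dots> = total_deg g N * n_bad U w n + n_exc * N ^ n"
    by (simp add: sum.distrib total_deg_def n_exc_def sum_distrib_right)
  finally show ?thesis .
qed

text \<open>The finite exceptional values of words of length at most \<open>m\<close>: a letter
  \<open>j\<close> followed by a word of length below \<open>m\<close>.\<close>

definition crit :: "nat \<Rightarrow> complex set" where
  "crit m = (\<Union>l<m. \<Union>js\<in>words N l. \<Union>j<N. \<Union>v\<in>exc_vals j. set_option (word g js (Some v)))"

lemma finite_crit: "finite (crit m)"
  unfolding crit_def using finite_exc_vals by auto

lemma generic_not_crit: "generic w \<Longrightarrow> w \<notin> crit m"
  by (auto simp: generic_def crit_def words_def)

text \<open>If a branch of a word shorter than \<open>m\<close> met an exceptional value, applying
  the word would give a point of \<open>crit m\<close> in \<open>U\<close>. So no branch is lost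
  during the first \<open>m\<close> steps.\<close>

lemma good_eq_fib:
  assumes U: "open U" "simply_connected U" "w \<in> U" "U \<inter> crit m = {}" and w: "generic w"
    and xs: "set xs \<subseteq> {..<N}" "length xs \<le> m"
  shows "good U xs w = fib xs w"
  using xs
proof (induction xs)
  case Nil
  have "branch U [] (\<lambda>z. z)" by (auto simp: branch_def)
  then show ?case using good_subset_fib[OF U(3), of "[]"] by (auto simp: good_def)
next
  case (Cons j js)
  then have j: "j < N" and js: "set js \<subseteq> {..<N}" "length js < m" by auto
  have "hits (exc_vals j) U js w = {}"
  proof (rule ccontr)
    assume "hits (exc_vals j) U js w \<noteq> {}"
    then obtain h z where hz: "branch U js h" "z \<in> U" "h z \<in> exc_vals j" unfolding hits_def by blast
    then have "word g js (Some (h z)) = Some z" by (simp add: branch_def)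
    then have "z \<in> set_option (word g js (Some (h z)))" by simp
    moreover have "js \<in> words N (length js)" using js by (simp add: words_def)
    ultimately have "z \<in> crit m" unfolding crit_def using js(2) j hz(3) by blast
    then show False using U(4) hz(2) by blast
  qed
  then have "fib (j # js) w \<subseteq> good U (j # js) w"
    using Cons fib_Cons[OF w js(1), of j] good_Cons[OF U(1-3) j] by auto
  then show ?case using good_subset_fib[OF U(3)] by blast
qed

text \<open>The recursion of \<open>n_bad_Suc\<close> starts from 0 at length \<open>m\<close>.
  Losses per step grow like N^n only, so their share of D^n is a convergent geometric sum of order
  (N/D)^m, small for large \<open>m\<close>.\<close>

lemma n_bad_bound:
  assumes U: "open U" "simply_connected U" "w \<in> U" "U \<inter> crit m = {}" and w: "generic w" and n: "m \<le> n"
  shows "real (n_bad U w n) \<le> n_exc / (D - N) * (N / D) ^ m * D ^ n"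
proof -
  define K where "K = n_exc / (D - N)"
  have K: "0 \<le> K" "K * D - n_exc = K * N"
    using N_less_D by (simp_all add: K_def field_simps)
  \<comment> \<open>The right-hand side is the exact solution of the recursion with equality;
    \<open>K\<close> satisfies K D - n_exc = K N.\<close>
  have "real (n_bad U w (m + k)) \<le> K * (real N ^ m * D ^ k - real N ^ (m + k))" for k
  proof (induction k)
    case 0
    have "n_bad U w m = 0" unfolding n_bad_def
      by (rule sum.neutral) (use good_eq_fib[OF U w] in \<open>auto simp: words_def\<close>)
    then show ?case by simp
  next
    case (Suc k)
    have "real (n_bad U w (Suc (m + k))) \<le> real (total_deg g N * n_bad U w (m + k) + n_exc * N ^ (m + k))"
      using n_bad_Suc[OF U(1-3) w] by (simp only: of_nat_le_iff)
    also have "\<dots> = D * n_bad U w (m + k) + n_exc * real N ^ (m + k)" by simp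
    also have "\<dots> \<le> D * (K * (real N ^ m * D ^ k - real N ^ (m + k))) + n_exc * real N ^ (m + k)"
      using Suc D_pos by (intro add_right_mono mult_left_mono) auto
    also have "\<dots> = K * (real N ^ m * D ^ Suc k) - (K * D - n_exc) * real N ^ (m + k)"
      by (simp add: algebra_simps)
    also have "\<dots> = K * (real N ^ m * D ^ Suc k - real N ^ (m + Suc k))"
      unfolding K(2) by (simp add: algebra_simps)
    finally show ?case by simp
  qed
  from this[of "n - m"] have "real (n_bad U w n) \<le> K * (real N ^ m * D ^ (n - m) - real N ^ n)" using n by simp
  also have "\<dots> \<le> K * (real N ^ m * D ^ (n - m))"
    using K by (intro mult_left_mono) auto
  also have "real N ^ m * D ^ (n - m) = (N / D) ^ m * D ^ n"
    using D_pos n by (simp add: power_divide power_diff)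
  finally show ?thesis by (simp add: K_def mult.assoc)
qed

end

section \<open>A slit plane of full measure\<close>

context equilibrium
begin

text \<open>The half-lines from \<open>v\<close> in different directions are disjoint, and those of
  positive measure are atoms of the image of \<mu> under the direction map. A finite measure has
  countably many atoms.\<close>

lemma countable_heavy_directions:
  "countable {s. measure \<mu> {x. \<exists>z. x = Some z \<and> sgn (z - v) = s} \<noteq> 0}"
proof -
  \<comment> \<open>The value 2 is not in the range of \<open>sgn\<close>, so infinity is kept apart
    from all directions.\<close>
  define \<tau> :: "p1 \<Rightarrow> complex" where "\<tau> x = (case x of None \<Rightarrow> 2 | Some z \<Rightarrow> sgn (z - v))" for x
  have \<tau>: "\<tau> \<in> measurable \<mu> borel"
    by (rule measurable_muI) (simp add: \<tau>_def)
  interpret T: finite_measure "distr \<mu> borel \<tau>" by (rule finite_measure_distr[OF \<tau>])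
  have "{s. measure \<mu> {x. \<exists>z. x = Some z \<and> sgn (z - v) = s} \<noteq> 0}
      \<subseteq> {s. measure (distr \<mu> borel \<tau>) {s} \<noteq> 0}"
  proof (rule subsetI, rule CollectI, rule notI)
    fix s assume s: "s \<in> {s. measure \<mu> {x. \<exists>z. x = Some z \<and> sgn (z - v) = s} \<noteq> 0}"
      "measure (distr \<mu> borel \<tau>) {s} = 0"
    have "measure \<mu> {x. \<exists>z. x = Some z \<and> sgn (z - v) = s} \<le> measure \<mu> (\<tau> -` {s})"
      using measurable_sets[OF \<tau>, of "{s}"] by (intro finite_measure_mono) (auto simp: \<tau>_def)
    also have "\<dots> = measure (distr \<mu> borel \<tau>) {s}"
      using \<tau> by (simp add: measure_distr)
    finally show False using s measure_nonneg[of \<mu> "{x. \<exists>z. x = Some z \<and> sgn (z - v) = s}"] by simp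
  qed
  then show ?thesis using T.countable_support countable_subset by blast
qed

text \<open>The centre moves along a horizontal line. For each \<open>v\<close> only countably many
  positions give a ray in a direction of positive measure or through \<open>w\<close>. Since points
  have measure zero, the rays of any other centre form a null set.\<close>

lemma ex_slit_center:
  assumes V: "finite V" "w \<notin> V"
  shows "\<exists>c. w \<in> slit_plane c V \<and> slit_plane c V \<inter> V = {} \<and> measure \<mu> (Some ` slit_plane c V) = 1"
proof -
  \<comment> \<open>The line at height \<open>y0\<close> misses \<open>V\<close>, so v - c has a
    fixed nonzero imaginary part and its direction determines the centre.\<close>
  obtain y0 :: real where y0: "y0 \<notin> Im ` V"
    using V(1) infinite_UNIV_char_0[where 'a=real] by (metis ex_new_if_finite finite_imageI)
  define A where "A v = {s. measure \<mu> {x. \<exists>z. x = Some z \<and> sgn (z - v) = s} \<noteq> 0} \<union> {sgn (w - v)}" for v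
  have "countable {t. sgn (v - Complex t y0) \<in> A v}" if v: "v \<in> V" for v
  proof (rule countable_image_inj_on)
    show "countable ((\<lambda>t. sgn (v - Complex t y0)) ` {t. sgn (v - Complex t y0) \<in> A v})"
      by (rule countable_subset[of _ "A v"]) (use countable_heavy_directions in \<open>auto simp: A_def\<close>)
    show "inj_on (\<lambda>t. sgn (v - Complex t y0)) {t. sgn (v - Complex t y0) \<in> A v}"
    proof (rule inj_onI)
      fix s t assume st: "sgn (v - Complex s y0) = sgn (v - Complex t y0)"
      let ?a = "v - Complex s y0" and ?b = "v - Complex t y0"
      have im: "Im ?a = Im ?b" "Im ?b \<noteq> 0" using y0 v by auto
      then have nz: "cmod ?a \<noteq> 0" "cmod ?b \<noteq> 0" by auto
      have "Im ?a / cmod ?a = Im ?b / cmod ?b" "Re ?a / cmod ?a = Re ?b / cmod ?b"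
        using st by (metis Im_sgn, metis Re_sgn)
      then have "cmod ?a = cmod ?b" "Re ?a / cmod ?a = Re ?b / cmod ?b"
        using im nz by (auto simp: frac_eq_eq)
      then have "Re ?a = Re ?b" using nz by auto
      then show "s = t" by simp
    qed
  qed
  then have "countable (\<Union>v\<in>V. {t. sgn (v - Complex t y0) \<in> A v})"
    using V(1) by (intro countable_UN) (auto intro: countable_finite)
  then obtain t where t: "\<And>v. v \<in> V \<Longrightarrow> sgn (v - Complex t y0) \<notin> A v"
    using uncountable_UNIV_real by (metis (mono_tags, lifting) UNIV_eq_I UN_iff mem_Collect_eq)
  define c where "c = Complex t y0"
  have cV: "v \<noteq> c" if "v \<in> V" for v using y0 that by (force simp: c_def)
  have ray: "z = v \<or> sgn (z - v) = sgn (v - c)" if v: "v \<in> V" and z: "z \<in> ray c v" for v z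
  proof -
    obtain s where s: "1 \<le> s" "z = c + complex_of_real s * (v - c)" using z ray_eq[OF cV[OF v]] by blast
    then have eq: "z - v = complex_of_real (s - 1) * (v - c)" by (simp add: algebra_simps)
    have "sgn (z - v) = complex_of_real (sgn (s - 1)) * sgn (v - c)"
      unfolding eq sgn_mult sgn_of_real ..
    then show ?thesis using s(1) eq by (cases "s = 1") auto
  qed
  have "w \<in> slit_plane c V"
    using ray V(2) t unfolding slit_plane_def A_def c_def by fastforce
  moreover have "slit_plane c V \<inter> V = {}"
  proof -
    have "v \<in> ray c v" if "v \<in> V" for v using cV[OF that] by (simp add: ray_def)
    then show ?thesis by (auto simp: slit_plane_def)
  qed
  moreover have "measure \<mu> (Some ` slit_plane c V) = 1"
  proof -
    let ?H = "\<lambda>v. {x. \<exists>z. x = Some z \<and> sgn (z - v) = sgn (v - c)}"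
    let ?Z = "{None} \<union> (\<Union>v\<in>V. {Some v} \<union> ?H v)"
    have pt: "{a} \<in> null_sets \<mu>" for a
    proof -
      have "Some -` {a} \<in> sets borel" by (cases a) (auto simp: vimage_def)
      then show ?thesis using measure_point[of a]
        by (intro null_setsI) (auto simp: sets_mu emeasure_eq_measure)
    qed
    have H: "?H v \<in> null_sets \<mu>" if "v \<in> V" for v
    proof (rule null_setsI)
      show "emeasure \<mu> (?H v) = 0" using t[OF that] by (simp add: A_def c_def emeasure_eq_measure)
      have "(\<lambda>z. sgn (z - v)) -` {sgn (v - c)} \<in> sets borel"
        by (rule measurable_sets_borel[of _ borel]) auto
      then show "?H v \<in> sets \<mu>" by (simp add: sets_mu vimage_def)
    qed
    have Z: "?Z \<in> null_sets \<mu>"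
      using V(1) pt H by (intro null_sets.Un null_sets.finite_UN) auto
    have S: "Some ` slit_plane c V \<in> sets \<mu>"
      using open_slit_plane[OF V(1)] by (simp add: sets_mu inj_vimage_image_eq)
    have "x \<in> Some ` slit_plane c V \<union> ?Z" for x
    proof (cases x)
      case (Some z)
      then show ?thesis using ray[of _ z] by (cases "z \<in> slit_plane c V") (auto simp: slit_plane_def)
    qed simp
    then have "Some ` slit_plane c V \<union> ?Z = UNIV" by blast
    then show ?thesis using measure_Un_null_set[OF S Z] measure_UNIV by simp
  qed
  ultimately show ?thesis by blast
qed

end

section \<open>Equidistribution\<close>

lemma compact_UN_cball:
  fixes K :: "complex set"
  assumes "compact K"
  shows "compact (\<Union>x\<in>K. cball x e)"
proof -
  have "(\<Union>x\<in>K. cball x e) = {x + y |x y. x \<in> K \<and> y \<in> cball 0 e}"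
  proof (intro set_eqI iffI)
    fix z assume "z \<in> (\<Union>x\<in>K. cball x e)"
    then obtain x where "x \<in> K" "dist x z \<le> e" by auto
    then have "z = x + (z - x)" "x \<in> K" "z - x \<in> cball 0 e" by (auto simp: dist_norm norm_minus_commute)
    then show "z \<in> {x + y |x y. x \<in> K \<and> y \<in> cball 0 e}" by blast
  next
    fix z assume "z \<in> {x + y |x y. x \<in> K \<and> y \<in> cball 0 e}"
    then obtain x y where xy: "x \<in> K" "cmod y \<le> e" "z = x + y" by auto
    then have "z \<in> cball x e" by (simp add: dist_norm)
    then show "z \<in> (\<Union>x\<in>K. cball x e)" using xy(1) by blast
  qed
  then show ?thesis using compact_sums[OF assms compact_cball[of 0 e]] by simp
qed

lemma p1_continuous_uniform:
  assumes \<phi>: "p1_continuous \<phi>" and K: "compact K" and \<eta>: "0 < \<eta>"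
  shows "\<exists>\<delta>>0. \<forall>x\<in>K. \<forall>y. dist y x \<le> \<delta> \<longrightarrow> \<bar>\<phi> (Some y) - \<phi> (Some x)\<bar> \<le> \<eta>"
proof -
  let ?K = "\<Union>x\<in>K. cball x 1"
  have "uniformly_continuous_on ?K (\<lambda>z. \<phi> (Some z))"
    using \<phi> compact_UN_cball[OF K]
    by (intro compact_uniformly_continuous) (auto simp: p1_continuous_def intro: continuous_on_subset)
  then obtain d where d: "0 < d" "\<And>x y. x \<in> ?K \<Longrightarrow> y \<in> ?K \<Longrightarrow> dist y x < d \<Longrightarrow> dist (\<phi> (Some y)) (\<phi> (Some x)) < \<eta>"
    unfolding uniformly_continuous_on_def using \<eta> by meson
  show ?thesis
  proof (intro exI[of _ "min 1 (d / 2)"] conjI ballI allI impI)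
    show "0 < min 1 (d / 2)" using d(1) by simp
    fix x y assume x: "x \<in> K" and y: "dist y x \<le> min 1 (d / 2)"
    have "x \<in> cball x 1" "y \<in> cball x 1" using y by (auto simp: dist_commute)
    then have "x \<in> ?K" "y \<in> ?K" using x by blast+
    moreover have "dist y x < d" using y d(1) by auto
    ultimately show "\<bar>\<phi> (Some y) - \<phi> (Some x)\<bar> \<le> \<eta>"
      using d(2)[of x y] by (simp add: dist_real_def)
  qed
qed

context rational_generators
begin

text \<open>Branches omitting the grid \<open>G\<close> are nearly constant on an e-neighbourhood of
  \<open>K\<close>. If the value at \<open>w\<close> lies in \<open>K\<close>, the branch contracts
  the disc of radius \<open>e\<close> about that value, and its attracting fixed point is repelling
  for the word.\<close>

lemma branch_fixed_point:
  assumes U: "open U" "connected U" "w \<in> U" and K: "compact K" "K \<subseteq> U" and \<delta>: "0 < \<delta>"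
  shows "\<exists>G. finite G \<and> (\<forall>xs h. branch U xs h \<longrightarrow> h w \<in> K \<longrightarrow> h ` U \<inter> G = {} \<longrightarrow>
    (\<exists>x\<in>U. h x = x \<and> repelling_fixed (word g xs) (Some x) \<and> dist x (h w) \<le> \<delta>))"
proof -
  obtain e where e: "0 < e" "(\<Union>x\<in>K. cball x e) \<subseteq> U"
    using compact_subset_open_imp_cball_epsilon_subset[OF K(1) U(1) K(2)] by blast
  have "0 < min \<delta> (e / 4)" using \<delta> e(1) by simp
  from small_oscillation[OF U compact_UN_cball[OF K(1)] e(2) K(1) this]
  obtain G where G: "finite G" "\<And>h z. h holomorphic_on U \<Longrightarrow> h w \<in> K \<Longrightarrow> h ` U \<inter> G = {} \<Longrightarrow>
    z \<in> (\<Union>x\<in>K. cball x e) \<Longrightarrow> dist (h z) (h w) \<le> min \<delta> (e / 4)"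
    by blast
  have "\<exists>x\<in>U. h x = x \<and> repelling_fixed (word g xs) (Some x) \<and> dist x (h w) \<le> \<delta>"
    if h: "branch U xs h" "h w \<in> K" "h ` U \<inter> G = {}" for xs h
  proof -
    have hol: "h holomorphic_on U" using h(1) by (simp add: branch_def)
    have sub: "cball (h w) e \<subseteq> (\<Union>x\<in>K. cball x e)" using h(2) by blast
    have osc: "dist (h z) (h w) \<le> min \<delta> (e / 4)" if "z \<in> cball (h w) e" for z
      using G(2)[OF hol h(2,3)] sub that by blast
    obtain x where x: "x \<in> cball (h w) (e / 4)" "h x = x" "cmod (deriv h x) < 1"
      using contracting_fixed_point[OF hol e(1), of "h w"] osc sub e(2) by force
    have xe: "x \<in> cball (h w) e" using x(1) e(1) by auto
    then have xU: "x \<in> U" using sub e(2) by blast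
    have "repelling_fixed (word g xs) (Some x)"
      using h(1) by (intro inverse_branch_repelling[OF U(1) hol _ xU x(2,3)]) (simp add: branch_def)
    moreover have "dist x (h w) \<le> \<delta>" using osc[OF xe] x(2) by simp
    ultimately show ?thesis using xU x(2) by blast
  qed
  then show ?thesis using G(1) by blast
qed

text \<open>Each preimage in \<open>S\<close> is sent to the fixed point of its branch. Two branches
  with the same fixed point share a value and hence coincide, so the assignment is injective. Moving
  to the fixed point costs \<eta> per preimage, and each point outside \<open>S\<close> costs at
  most \<open>M\<close>.\<close>

lemma sum_repelling_ge:
  fixes \<phi> :: "p1 \<Rightarrow> real" and M \<eta> \<delta> :: real
  assumes U: "open U" "connected U" "w \<in> U" and w: "generic w" and xs: "set xs \<subseteq> {..<N}"
    and G: "finite G" "\<And>h. branch U xs h \<Longrightarrow> h w \<in> K \<Longrightarrow> h ` U \<inter> G = {} \<Longrightarrow>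
      \<exists>x\<in>U. h x = x \<and> repelling_fixed (word g xs) (Some x) \<and> dist x (h w) \<le> \<delta>"
    and \<phi>: "\<And>x. 0 \<le> \<phi> x" "\<And>x. \<phi> x \<le> M"
    and \<delta>: "\<And>x y. x \<in> K \<Longrightarrow> dist y x \<le> \<delta> \<Longrightarrow> \<bar>\<phi> (Some y) - \<phi> (Some x)\<bar> \<le> \<eta>" and \<eta>: "0 \<le> \<eta>"
  shows "(\<Sum>z\<in>fib xs w. \<phi> (Some z)) - \<eta> * card (fib xs w)
      - M * (card (fib xs w - good U xs w) + card (fib xs w - K) + card G)
    \<le> (\<Sum>x | repelling_fixed (word g xs) x. \<phi> x)"
proof -
  let ?F = "fib xs w" and ?B = "(fib xs w - good U xs w) \<union> (fib xs w - K) \<union> hits G U xs w"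
  define S where "S = ?F - ?B"
  have fin: "finite ?F" by (rule finite_fib[OF w xs])
  have H: "finite (hits G U xs w)" "card (hits G U xs w) \<le> card G"
    using hits_card[OF U G(1)] by auto
  have M: "0 \<le> M" using \<phi> order_trans by blast
  have "\<exists>h y. branch U xs h \<and> h w = x \<and> y \<in> U \<and> h y = y \<and> repelling_fixed (word g xs) (Some y) \<and> dist y x \<le> \<delta>"
    if "x \<in> S" for x
  proof -
    have x: "x \<in> good U xs w" "x \<in> K" "x \<notin> hits G U xs w" using that by (auto simp: S_def)
    then obtain h where h: "branch U xs h" "h w = x" by (auto simp: good_def)
    then have "h ` U \<inter> G = {}" using x(3) by (auto simp: hits_def)
    then show ?thesis using G(2)[of h] h x(2) by blast
  qed
  then obtain h y where hy: "\<And>x. x \<in> S \<Longrightarrow> branch U xs (h x) \<and> h x w = x \<and> y x \<in> U \<and> h x (y x) = y x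
      \<and> repelling_fixed (word g xs) (Some (y x)) \<and> dist (y x) x \<le> \<delta>"
    by metis
  have inj: "inj_on (\<lambda>x. Some (y x)) S"
  proof (rule inj_onI)
    fix a b assume ab: "a \<in> S" "b \<in> S" "Some (y a) = Some (y b)"
    then have "h a w = h b w"
      using hy[OF ab(1)] hy[OF ab(2)] U by (intro branch_unique[of U xs "h a" "h b" "y a" "y b" w]) auto
    then show "a = b" using hy[OF ab(1)] hy[OF ab(2)] by simp
  qed
  have "(\<Sum>z\<in>?F. \<phi> (Some z)) = (\<Sum>z\<in>S. \<phi> (Some z)) + (\<Sum>z\<in>?F \<inter> ?B. \<phi> (Some z))"
    using fin sum.Int_Diff[of ?F "\<lambda>z. \<phi> (Some z)" ?B] by (simp add: S_def)
  also have "\<dots> \<le> (\<Sum>z\<in>S. \<phi> (Some (y z)) + \<eta>) + (\<Sum>z\<in>?F \<inter> ?B. M)"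
  proof (intro add_mono sum_mono)
    fix z assume "z \<in> S"
    then show "\<phi> (Some z) \<le> \<phi> (Some (y z)) + \<eta>"
      using \<delta>[of z "y z"] hy[of z] by (force simp: S_def)
  qed (rule \<phi>)
  also have "\<dots> = (\<Sum>x\<in>(\<lambda>x. Some (y x)) ` S. \<phi> x) + \<eta> * card S + M * card (?F \<inter> ?B)"
    by (simp add: sum.reindex[OF inj] sum.distrib mult.commute)
  also have "\<dots> \<le> (\<Sum>x | repelling_fixed (word g xs) x. \<phi> x) + \<eta> * card ?F
      + M * (card (?F - good U xs w) + card (?F - K) + card G)"
  proof (intro add_mono mult_left_mono sum_mono2)
    show "finite {x. repelling_fixed (word g xs) x}"
      using nonconst_word[where g = g and N = N, OF nonconst xs] by (intro finite_repelling_fixed(1)) simp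
    show "(\<lambda>x. Some (y x)) ` S \<subseteq> {x. repelling_fixed (word g xs) x}" using hy by auto
    show "real (card S) \<le> real (card ?F)" using fin by (auto simp: S_def intro!: card_mono)
    have "card (?F \<inter> ?B) \<le> card ?B" using fin H by (intro card_mono) auto
    also have "\<dots> \<le> card (?F - good U xs w) + card (?F - K) + card (hits G U xs w)"
      by (meson card_Un_le add_le_mono le_trans le_refl)
    finally have "card (?F \<inter> ?B) \<le> card (?F - good U xs w) + card (?F - K) + card G" using H(2) by linarith
    then show "real (card (?F \<inter> ?B)) \<le> real (card (?F - good U xs w) + card (?F - K) + card G)"
      by (simp only: of_nat_le_iff)
  qed (use \<phi> M \<eta> in auto)
  finally show ?thesis by (simp add: algebra_simps)
qed

end

context equilibrium
begin

text \<open>Almost all of \<mu> lies in a compact part of \<open>U\<close>. A continuous cutoff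
  function that is 1 there and 0 outside a larger compact \<open>K\<close> transfers this to the
  preimages through weak convergence.\<close>

lemma preimages_in_compact:
  assumes U: "open U" "measure \<mu> (Some ` U) = 1" and w: "generic w"
    and conv: "\<And>\<phi>. p1_continuous \<phi> \<Longrightarrow> (\<lambda>n. pullback_pair g N n (Some w) \<phi> / D ^ n) \<longlonglongrightarrow> integral\<^sup>L \<mu> \<phi>"
    and e: "0 < e"
  shows "\<exists>K. compact K \<and> K \<subseteq> U \<and> (\<forall>\<^sub>F n in sequentially.
    real (\<Sum>xs\<in>words N n. card (fib xs w - K)) \<le> e * D ^ n)"
proof -
  obtain C where C: "\<And>n. compact (C n)" "\<And>n. C n \<subseteq> U" "\<And>n. C n \<subseteq> interior (C (Suc n))" "\<Union>(range C) = U"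
    using open_Union_compact_subsets[OF U(1)] by metis
  have sets: "Some ` C n \<in> sets \<mu>" for n
    using C(1) by (simp add: sets_mu inj_vimage_image_eq compact_imp_closed borel_closed)
  have "incseq (\<lambda>n. Some ` C n)"
    using C(3) interior_subset by (intro incseq_SucI image_mono) blast
  then have "(\<lambda>n. measure \<mu> (Some ` C n)) \<longlonglongrightarrow> measure \<mu> (\<Union>n. Some ` C n)"
    using sets by (intro finite_Lim_measure_incseq) auto
  moreover have "(\<Union>n. Some ` C n) = Some ` U" using C(4) by auto
  ultimately have "\<forall>\<^sub>F n in sequentially. 1 - e < measure \<mu> (Some ` C n)"
    using U(2) e by (intro order_tendstoD(1)[of _ 1]) auto
  then obtain k where k: "1 - e < measure \<mu> (Some ` C k)"
    using eventually_happens'[OF sequentially_bot] by blast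
  define K where "K = C (Suc k)"
  have K: "compact K" "K \<subseteq> U" "C k \<subseteq> interior K" using C by (auto simp: K_def)
  obtain \<psi>0 :: "complex \<Rightarrow> real" where \<psi>0: "continuous_on UNIV \<psi>0" "\<And>x. \<psi>0 x \<in> closed_segment 1 0"
    "\<And>x. x \<in> C k \<Longrightarrow> \<psi>0 x = 1" "\<And>x. x \<in> - interior K \<Longrightarrow> \<psi>0 x = 0"
    using Urysohn[of "C k" "- interior K" 1 0] compact_imp_closed[OF C(1)] K(3) by blast
  have r: "0 \<le> \<psi>0 x" "\<psi>0 x \<le> 1" for x using \<psi>0(2)[of x] by (auto simp: closed_segment_eq_real_ivl)
  define \<psi> where "\<psi> x = (case x of None \<Rightarrow> 0 | Some z \<Rightarrow> \<psi>0 z)" for x :: p1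
  have supp: "\<psi>0 z = 0" if "z \<notin> K" for z using \<psi>0(4)[of z] interior_subset[of K] that by blast
  have "p1_continuous \<psi>"
  proof -
    obtain b where b: "K \<subseteq> ball 0 b" using compact_imp_bounded[OF K(1)] bounded_subset_ballD by blast
    have "\<psi>0 z = 0" if "b \<le> norm z" for z
      using b that by (intro supp) auto
    then have "\<forall>\<^sub>F z in at_infinity. \<psi>0 z = 0"
      unfolding eventually_at_infinity by blast
    then have "(\<psi>0 \<longlongrightarrow> 0) at_infinity" by (rule tendsto_eventually)
    then show ?thesis using \<psi>0(1) by (simp add: p1_continuous_def \<psi>_def)
  qed
  have "measure \<mu> (Some ` C k) = (\<integral>x. indicator (Some ` C k) x \<partial>\<mu>)" by simp
  also have "\<dots> \<le> integral\<^sup>L \<mu> \<psi>"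
  proof (rule integral_mono)
    show "integrable \<mu> (indicator (Some ` C k) :: p1 \<Rightarrow> real)"
      using sets by (intro integrable_real_indicator) (auto simp: emeasure_eq_measure)
    show "integrable \<mu> \<psi>" by (rule integrable_p1_continuous) fact
    show "indicator (Some ` C k) x \<le> \<psi> x" for x
      using r \<psi>0(3) by (cases x) (auto simp: \<psi>_def indicator_def)
  qed
  finally have "1 - e < integral\<^sup>L \<mu> \<psi>" using k by simp
  then have "\<forall>\<^sub>F n in sequentially. 1 - e < pullback_pair g N n (Some w) \<psi> / D ^ n"
    by (rule order_tendstoD(1)[OF conv[OF \<open>p1_continuous \<psi>\<close>]])
  then have "\<forall>\<^sub>F n in sequentially. real (\<Sum>xs\<in>words N n. card (fib xs w - K)) \<le> e * D ^ n"
  proof eventually_elim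
    case (elim n)
    have "real (card (fib xs w - K)) \<le> real (card (fib xs w)) - (\<Sum>z\<in>fib xs w. \<psi> (Some z))"
      if "xs \<in> words N n" for xs
    proof -
      have fin: "finite (fib xs w)" using finite_fib[OF w] that by (auto simp: words_def)
      have "real (card (fib xs w - K)) = (\<Sum>z\<in>fib xs w - K. 1)" by simp
      also have "\<dots> = (\<Sum>z\<in>fib xs w - K. 1 - \<psi> (Some z))"
        by (rule sum.cong) (auto simp: \<psi>_def supp)
      also have "\<dots> \<le> (\<Sum>z\<in>fib xs w. 1 - \<psi> (Some z))"
        using fin r by (intro sum_mono2) (auto simp: \<psi>_def)
      finally show ?thesis by (simp add: sum_subtractf)
    qed
    then have "(\<Sum>xs\<in>words N n. real (card (fib xs w - K)))
        \<le> (\<Sum>xs\<in>words N n. real (card (fib xs w)) - (\<Sum>z\<in>fib xs w. \<psi> (Some z)))"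
      by (rule sum_mono)
    also have "\<dots> = D ^ n - pullback_pair g N n (Some w) \<psi>"
      by (simp add: sum_subtractf sum_card_fib[OF w] pullback_pair_generic[OF w])
    also have "\<dots> \<le> e * D ^ n"
    proof -
      have "0 < D ^ n" using D_pos by simp
      then have "(1 - e) * D ^ n < pullback_pair g N n (Some w) \<psi>"
        using elim by (simp only: pos_less_divide_eq)
      then show ?thesis by (simp add: left_diff_distrib)
    qed
    finally show ?case by simp
  qed
  then show ?thesis using K by blast
qed

text \<open>The choices depend on each other in this order: \<open>w\<close>, then \<open>m\<close>
  and the slit plane \<open>U\<close>, then \<open>K\<close>, then \<delta> and the grid
  \<open>G\<close>; only then is the word length \<open>n\<close> taken large.\<close>

lemma rep_pair_lower:
  assumes \<phi>: "p1_continuous \<phi>" "\<And>x. 0 \<le> \<phi> x" and \<epsilon>: "0 < \<epsilon>"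
  shows "\<forall>\<^sub>F n in sequentially. integral\<^sup>L \<mu> \<phi> - \<epsilon> \<le> rep_pair g N n \<phi> / D ^ n"
proof -
  obtain M where M: "0 \<le> M" "\<And>x. \<phi> x \<le> M" using p1_continuous_bounded[OF \<phi>(1)] abs_le_D1 by metis
  \<comment> \<open>Two errors \<eta> come from the convergence at \<open>w\<close> and from moving
    preimages to fixed points. Three more, weighted by \<open>M\<close>, come from preimages without
    a branch, outside \<open>K\<close>, or with a branch meeting \<open>G\<close>.\<close>
  define \<eta> where "\<eta> = \<epsilon> / (2 + 3 * M)"
  have \<eta>: "0 < \<eta>" "2 * \<eta> + M * (3 * \<eta>) = \<epsilon>"
  proof -
    have p: "0 < 2 + 3 * M" using M(1) by simp
    then show "0 < \<eta>" using \<epsilon> by (simp add: \<eta>_def)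
    have "(2 + 3 * M) * \<eta> = \<epsilon>" using p by (simp add: \<eta>_def)
    then show "2 * \<eta> + M * (3 * \<eta>) = \<epsilon>" by (simp add: algebra_simps)
  qed
  obtain w where w: "generic w"
    "\<And>\<phi>. p1_continuous \<phi> \<Longrightarrow> (\<lambda>n. pullback_pair g N n (Some w) \<phi> / D ^ n) \<longlonglongrightarrow> integral\<^sup>L \<mu> \<phi>"
    by (rule ex_generic_point[of "\<lambda>_. True"]) auto
  have ratio: "(\<lambda>n. (N / D) ^ n) \<longlonglongrightarrow> 0"
    using N_less_D by (intro LIMSEQ_power_zero) simp
  have "(\<lambda>m. n_exc / (D - N) * (N / D) ^ m) \<longlonglongrightarrow> n_exc / (D - N) * 0"
    by (intro tendsto_intros ratio)
  then have "\<forall>\<^sub>F m in sequentially. n_exc / (D - N) * (N / D) ^ m < \<eta>"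
    using \<eta> by (intro order_tendstoD(2)) auto
  then obtain m where m: "n_exc / (D - N) * (N / D) ^ m < \<eta>"
    using eventually_happens'[OF sequentially_bot] by blast
  obtain c where c: "w \<in> slit_plane c (crit m)" "slit_plane c (crit m) \<inter> crit m = {}"
    "measure \<mu> (Some ` slit_plane c (crit m)) = 1"
    using ex_slit_center[OF finite_crit generic_not_crit[OF w(1)]] by blast
  define U where "U = slit_plane c (crit m)"
  have U: "open U" "simply_connected U" "w \<in> U" "U \<inter> crit m = {}"
    using open_slit_plane[OF finite_crit] starlike_imp_simply_connected[OF starlike_slit_plane] c
    by (auto simp: U_def)
  have conn: "connected U" using U(2) by (rule simply_connected_imp_connected)
  obtain K where K: "compact K" "K \<subseteq> U" and Kc: "\<forall>\<^sub>F n in sequentially.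
      real (\<Sum>xs\<in>words N n. card (fib xs w - K)) \<le> \<eta> * D ^ n"
    using preimages_in_compact[OF U(1) _ w(1) w(2) \<eta>(1)] c(3) by (auto simp: U_def)
  obtain \<delta> where \<delta>: "0 < \<delta>" "\<And>x y. x \<in> K \<Longrightarrow> dist y x \<le> \<delta> \<Longrightarrow> \<bar>\<phi> (Some y) - \<phi> (Some x)\<bar> \<le> \<eta>"
    using p1_continuous_uniform[OF \<phi>(1) K(1) \<eta>(1)] by blast
  obtain G where G: "finite G" "\<And>xs h. branch U xs h \<Longrightarrow> h w \<in> K \<Longrightarrow> h ` U \<inter> G = {} \<Longrightarrow>
      \<exists>x\<in>U. h x = x \<and> repelling_fixed (word g xs) (Some x) \<and> dist x (h w) \<le> \<delta>"
    using branch_fixed_point[OF U(1) conn U(3) K \<delta>(1)] by blast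
  have lower: "pullback_pair g N n (Some w) \<phi> - \<eta> * D ^ n
      - M * (real (n_bad U w n) + real (\<Sum>xs\<in>words N n. card (fib xs w - K)) + card G * real N ^ n)
      \<le> rep_pair g N n \<phi>" for n
  proof -
    have "(\<Sum>xs\<in>words N n. (\<Sum>z\<in>fib xs w. \<phi> (Some z)) - \<eta> * card (fib xs w)
        - M * (card (fib xs w - good U xs w) + card (fib xs w - K) + card G)) \<le> rep_pair g N n \<phi>"
      unfolding rep_pair_def
    proof (rule sum_mono)
      fix xs assume "xs \<in> words N n"
      then have xs: "set xs \<subseteq> {..<N}" by (simp add: words_def)
      show "(\<Sum>z\<in>fib xs w. \<phi> (Some z)) - \<eta> * card (fib xs w)
          - M * (card (fib xs w - good U xs w) + card (fib xs w - K) + card G)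
        \<le> (\<Sum>x | repelling_fixed (word g xs) x. \<phi> x)"
        by (rule sum_repelling_ge[where \<phi> = \<phi> and K = K and \<delta> = \<delta> and \<eta> = \<eta>, OF U(1) conn U(3) w(1) xs G(1) G(2) \<phi>(2) M(2) \<delta>(2)]) (use \<eta> in auto)
    qed
    then show ?thesis
      by (simp add: sum_subtractf sum.distrib pullback_pair_generic[OF w(1)] sum_card_fib[OF w(1)]
          n_bad_def card_words mult.commute flip: sum_distrib_left)
  qed
  have "(\<lambda>n. card G * (N / D) ^ n) \<longlonglongrightarrow> real (card G) * 0" by (intro tendsto_intros ratio)
  then have "\<forall>\<^sub>F n in sequentially. card G * (N / D) ^ n < \<eta>"
    using \<eta> by (intro order_tendstoD(2)) auto
  moreover have "\<forall>\<^sub>F n in sequentially. integral\<^sup>L \<mu> \<phi> - \<eta> < pullback_pair g N n (Some w) \<phi> / D ^ n"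
    using \<eta> by (intro order_tendstoD(1)[OF w(2)[OF \<phi>(1)]]) simp
  ultimately show ?thesis
    using Kc eventually_ge_at_top[of m]
  proof eventually_elim
    case (elim n)
    have Dn: "0 < D ^ n" using D_pos by simp
    have 1: "(integral\<^sup>L \<mu> \<phi> - \<eta>) * D ^ n \<le> pullback_pair g N n (Some w) \<phi>"
      using elim(2) unfolding pos_less_divide_eq[OF Dn] by (rule less_imp_le)
    have "real (n_bad U w n) \<le> n_exc / (D - N) * (N / D) ^ m * D ^ n"
      by (rule n_bad_bound[OF U w(1) elim(4)])
    also have "\<dots> \<le> \<eta> * D ^ n" using m Dn by (intro mult_right_mono) auto
    finally have 2: "real (n_bad U w n) \<le> \<eta> * D ^ n" .
    have 3: "card G * real N ^ n \<le> \<eta> * D ^ n"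
      using elim(1) unfolding power_divide times_divide_eq_right pos_divide_less_eq[OF Dn]
      by (rule less_imp_le)
    have "M * (real (n_bad U w n) + real (\<Sum>xs\<in>words N n. card (fib xs w - K)) + card G * real N ^ n)
        \<le> M * (3 * \<eta> * D ^ n)"
      using 2 3 elim(3) M(1) by (intro mult_left_mono) auto
    then have "(integral\<^sup>L \<mu> \<phi> - \<eta>) * D ^ n - \<eta> * D ^ n - M * (3 * \<eta> * D ^ n) \<le> rep_pair g N n \<phi>"
      using lower[of n] 1 by linarith
    also have "(integral\<^sup>L \<mu> \<phi> - \<eta>) * D ^ n - \<eta> * D ^ n - M * (3 * \<eta> * D ^ n)
        = (integral\<^sup>L \<mu> \<phi> - (2 * \<eta> + M * (3 * \<eta>))) * D ^ n"
      by (simp add: algebra_simps)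
    finally show ?case unfolding \<eta>(2) pos_le_divide_eq[OF Dn] .
  qed
qed

text \<open>A word of degree \<open>d\<close> has only about \<open>d\<close> fixed points, so the total mass is at most 1 in the limit and
  the lower bounds for \<open>\<phi>\<close> and \<open>M - \<phi>\<close> together give convergence.\<close>
lemma rep_pair_tendsto:
  assumes \<phi>: "p1_continuous \<phi>"
  shows "(\<lambda>n. rep_pair g N n \<phi> / D ^ n) \<longlonglongrightarrow> integral\<^sup>L \<mu> \<phi>"
proof -
  obtain M where M: "0 \<le> M" "\<And>x. \<bar>\<phi> x\<bar> \<le> M" using p1_continuous_bounded[OF \<phi>] by blast
  define c where "c n = rep_pair g N n (\<lambda>_. 1)" for n
  have up: "p1_continuous (\<lambda>x. M + \<phi> x)" and dn: "p1_continuous (\<lambda>x. M - \<phi> x)"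
    using \<phi> by (auto simp: p1_continuous_def intro!: continuous_intros tendsto_intros)
  have int: "integrable \<mu> \<phi>" by (rule integrable_p1_continuous[OF \<phi>])
  have iup: "integral\<^sup>L \<mu> (\<lambda>x. M + \<phi> x) = M + integral\<^sup>L \<mu> \<phi>"
    and idn: "integral\<^sup>L \<mu> (\<lambda>x. M - \<phi> x) = M - integral\<^sup>L \<mu> \<phi>"
    using int measure_UNIV by simp_all
  have rup: "rep_pair g N n (\<lambda>x. M + \<phi> x) = M * c n + rep_pair g N n \<phi>"
    and rdn: "rep_pair g N n (\<lambda>x. M - \<phi> x) = M * c n - rep_pair g N n \<phi>" for n
    by (simp_all add: c_def rep_pair_def sum.distrib sum_subtractf sum_distrib_left mult.commute)
  have c: "c n \<le> D ^ n + 2 * real N ^ n" for n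
    using rep_card_le[of n] by (simp add: c_def rep_pair_def)
  show ?thesis
  proof (rule tendstoI)
    fix \<epsilon> :: real assume \<epsilon>: "0 < \<epsilon>"
    have "(\<lambda>n. M * (2 * (N / D) ^ n)) \<longlonglongrightarrow> M * (2 * 0)"
      using N_less_D by (intro tendsto_intros LIMSEQ_power_zero) simp
    then have "\<forall>\<^sub>F n in sequentially. M * (2 * (N / D) ^ n) < \<epsilon> / 2"
      using \<epsilon> by (intro order_tendstoD(2)) auto
    moreover have "\<forall>\<^sub>F n in sequentially. integral\<^sup>L \<mu> (\<lambda>x. M + \<phi> x) - \<epsilon> / 4 \<le> rep_pair g N n (\<lambda>x. M + \<phi> x) / D ^ n"
    proof (rule rep_pair_lower[OF up])
      show "0 \<le> M + \<phi> x" for x using M(2)[of x] by linarith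
    qed (use \<epsilon> in simp)
    moreover have "\<forall>\<^sub>F n in sequentially. integral\<^sup>L \<mu> (\<lambda>x. M - \<phi> x) - \<epsilon> / 4 \<le> rep_pair g N n (\<lambda>x. M - \<phi> x) / D ^ n"
    proof (rule rep_pair_lower[OF dn])
      show "0 \<le> M - \<phi> x" for x using M(2)[of x] by linarith
    qed (use \<epsilon> in simp)
    ultimately show "\<forall>\<^sub>F n in sequentially. dist (rep_pair g N n \<phi> / D ^ n) (integral\<^sup>L \<mu> \<phi>) < \<epsilon>"
    proof eventually_elim
      case (elim n)
      have Dn: "0 < D ^ n" using D_pos by simp
      \<comment> \<open>Inserted into the lower bounds for M + \<phi> and M - \<phi>, this bound on
        the total mass gives a lower and an upper bound for \<phi>, each with error
        3\<epsilon>/4.\<close>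
      have "M * c n / D ^ n \<le> M * (D ^ n + 2 * real N ^ n) / D ^ n"
        using c M(1) Dn by (intro divide_right_mono mult_left_mono) auto
      also have "\<dots> = M + M * (2 * (N / D) ^ n)"
        using Dn by (simp add: power_divide field_simps)
      finally have "M * c n / D ^ n \<le> M + \<epsilon> / 2" using elim(1) by linarith
      moreover have "M + integral\<^sup>L \<mu> \<phi> - \<epsilon> / 4 \<le> M * c n / D ^ n + rep_pair g N n \<phi> / D ^ n"
        using elim(2) unfolding iup rup by (simp add: add_divide_distrib)
      moreover have "M - integral\<^sup>L \<mu> \<phi> - \<epsilon> / 4 \<le> M * c n / D ^ n - rep_pair g N n \<phi> / D ^ n"
        using elim(3) unfolding idn rdn by (simp add: diff_divide_distrib)
      ultimately show ?case using \<epsilon> unfolding dist_real_def by linarith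
    qed
  qed
qed

end

theorem theorem1p1:
  fixes g :: "nat \<Rightarrow> p1 \<Rightarrow> p1" and N :: nat and \<mu> :: "p1 measure"
  assumes "1 \<le> N"
    and "\<forall>j<N. nonconst_holo_selfmap (g j)"
    and "\<exists>j<N. 2 \<le> rat_deg (g j)"
    and "is_equilibrium_measure g N \<mu>"
  shows "\<forall>\<phi>. p1_continuous \<phi> \<longrightarrow>
           (\<lambda>n. rep_pair g N n \<phi> / real (total_deg g N) ^ n) \<longlonglongrightarrow> integral\<^sup>L \<mu> \<phi>"
proof -
  interpret equilibrium g N \<mu> by standard (use assms in auto)
  show ?thesis using rep_pair_tendsto by blast
qed

end
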